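(* Let $\lambda\in\mathcal{SP}_n$ and $\mu\in\mathcal{OP}_n$. Then $$\zeta^{\lambda}_{\mu}(q)=\sum_{i=\lambda_1}^n\ \sum_{\tau\in\mathcal{C}^{\mu}_{i}}\ \sum_{\xi}(-1)^{i-\lambda_1}\,2^{\epsilon(\xi)-\epsilon(\lambda)+l(\tau)+a(\lambda^{[1]}/\xi)}\,(q-1)^{l(\tau)+l(\mu-\tau)-l(\mu)}\,(\tau)_q\,\zeta^{\xi}_{\mu-\tau}(q),$$ where $\xi$ runs over all strict partitions $\xi\subset\lambda^{[1]}$ such that $\lambda^{[1]}/\xi$ is a horizontal $(i-\lambda_1)$-strip.
   Context: Partitions and compositions: a composition is a finite sequence of nonnegative integers; for a partition or composition, $l$ denotes the number of nonzero parts; $\mathcal{SP}_n$ (resp. $\mathcal{OP}_n$) is the set of strict partitions (resp. partitions with all parts odd) of $n$; $\delta(\lambda)\in\{0,1\}$ is the parity of $l(\lambda)$; $\epsilon(\lambda)=\lfloor l(\lambda)/2\rfloor$; $z_\lambda=\prod_{i\ge1}i^{m_i}m_i!$ with $m_i$ the multiplicity of $i$ in $\lambda$. For $\lambda=(\lambda_1,\dots,\lambda_l)$, $\lambda^{[1]}=(\lambda_2,\dots,\lambda_l)$. For $\mu=(\mu_1,\dots,\mu_r)$, $\mathcal C^\mu_i$ is the set of compositions $\tau=(\tau_1,\dots,\tau_r)$ with $\sum_a\tau_a=i$ and $\tau_a\le\mu_a$ for all $a$; $\mu-\tau=(\mu_1-\tau_1,\dots,\mu_r-\tau_r)$. $(k)_q=\frac{q^k-(-1)^k}{q+1}$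 for $k>0$, $(0)_q=1$, and $(\tau)_q=\prod_a(\tau_a)_q$. Strips: for partitions $\xi\subset\lambda$, the (ordinary, unshifted) skew diagram $\lambda/\xi$ is a horizontal $r$-strip if it has $r$ boxes with at most one box in each column; $a(\lambda/\xi)$ is the number of integers $i\ge1$ such that $\lambda/\xi$ has a box in the $i$th column but not in the $(i+1)$th column. Ring and form: $\Gamma=\mathbb{Q}(q)[p_1,p_3,p_5,\dots]$ is generated by the odd power sums, with the bilinear form $\langle p_\lambda,p_\mu\rangle=2^{-l(\lambda)}z_\lambda\delta_{\lambda\mu}$ for odd partitions. Operators $Q_n$ ($n\in\mathbb Z$) on $\Gamma$ are defined by $\sum_{n}Q_nz^n=\exp\big(\sum_{n\ge1,\,\mathrm{odd}}\frac2n p_nz^n\big)\exp\big(-\sum_{n\ge1,\,\mathrm{odd}}\frac{\partial}{\partial p_n}z^{-n}\big)$, and for strict $\lambda=(\lambda_1,\dots,\lambda_l)$, $Q_\lambda=Q_{\lambda_1}\cdots Q_{\lambda_l}.1$ is Schur's $Q$-function ($Q_\emptyset=1$); $\langle Q_\lambda,Q_\mu\rangle=2^{l(\lambda)}\delta_{\lambda\mu}$. Characters: define $g_n\in\Gamma$ by $\sum_{n\ge0}g_nz^n=\exp\big(\sum_{n\ge1,\,\mathrm{odd}}\frac{2(q^n-1)}{n}p_nz^n\big)$ (so $g_0=1$), and $g_\mu=g_{\mu_1}g_{\mu_2}\cdots$ for any composition $\mu$. For a strict partition $\lambda$ and a composition $\mu$ of the same weight $n$, $\zeta^\lambda_\mu(q)$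 is the value of the irreducible character of the Hecke-Clifford algebra $\mathcal H^c_n$ labelled by $\lambda$ at the standard element $T_{\gamma_\mu}$; it is determined by the Frobenius formula $\frac{g_\mu}{(q-1)^{l(\mu)}}=\sum_{\lambda\in\mathcal{SP}_n}2^{-\frac{l(\lambda)+\delta(\lambda)}2}\zeta^\lambda_\mu(q)Q_\lambda$, equivalently $\zeta^\lambda_\mu(q)=2^{-\epsilon(\lambda)}(q-1)^{-l(\mu)}\langle g_\mu,Q_\lambda\rangle$, which may be taken as its definition. (Zero parts of $\mu$ and the order of its parts are irrelevant; $\zeta^\emptyset_\emptyset=1$.) *)

theory Defs
  imports
    "HOL-Computational_Algebra.Computational_Algebra"
    "HOL-Library.Poly_Mapping"
begin

text \<open>Compositions and partitions are lists of naturals. Compositions may contain zero parts;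
  partitions are weakly decreasing lists of positive naturals.\<close>

definition num_parts :: "nat list \<Rightarrow> nat" where
  "num_parts \<tau> = length (filter (\<lambda>a. a \<noteq> 0) \<tau>)"

definition eps :: "nat list \<Rightarrow> nat" where
  "eps lam = num_parts lam div 2"

definition SP :: "nat \<Rightarrow> nat list set" where
  "SP n = {lam. sorted_wrt (>) lam \<and> 0 \<notin> set lam \<and> sum_list lam = n}"

definition OP :: "nat \<Rightarrow> nat list set" where
  "OP n = {\<mu>. sorted_wrt (\<ge>) \<mu> \<and> (\<forall>a\<in>set \<mu>. odd a) \<and> sum_list \<mu> = n}"

text \<open>Rows are indexed from 0, so \<open>\<lambda>\<^sub>1\<close> is \<open>part \<lambda> 0\<close>; it is 0 for the empty partition.\<close>

definition part :: "nat list \<Rightarrow> nat \<Rightarrow> nat" where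
  "part lam i = (if i < length lam then lam ! i else 0)"

definition subcomps :: "nat list \<Rightarrow> nat \<Rightarrow> nat list set" where
  "subcomps \<mu> i = {\<tau>. length \<tau> = length \<mu> \<and> sum_list \<tau> = i \<and> (\<forall>a<length \<mu>. \<tau> ! a \<le> \<mu> ! a)}"

definition comp_diff :: "nat list \<Rightarrow> nat list \<Rightarrow> nat list" where
  "comp_diff \<mu> \<tau> = map2 (-) \<mu> \<tau>"

text \<open>Boxes are pairs (row, column), with columns indexed from 1.\<close>

definition skew_diagram :: "nat list \<Rightarrow> nat list \<Rightarrow> (nat \<times> nat) set" where
  "skew_diagram lam \<xi> = {(i, j). part \<xi> i < j \<and> j \<le> part lam i}"

definition diag_subset :: "nat list \<Rightarrow> nat list \<Rightarrow> bool" where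
  "diag_subset \<xi> lam \<longleftrightarrow> (\<forall>i. part \<xi> i \<le> part lam i)"

definition horizontal_strip :: "nat \<Rightarrow> nat list \<Rightarrow> nat list \<Rightarrow> bool" where
  "horizontal_strip r lam \<xi> \<longleftrightarrow> card (skew_diagram lam \<xi>) = r \<and>
     (\<forall>i i' j. (i, j) \<in> skew_diagram lam \<xi> \<longrightarrow> (i', j) \<in> skew_diagram lam \<xi> \<longrightarrow> i = i')"

definition strip_a :: "nat list \<Rightarrow> nat list \<Rightarrow> nat" where
  "strip_a lam \<xi> = card {j. 1 \<le> j \<and> (\<exists>i. (i, j) \<in> skew_diagram lam \<xi>)
                          \<and> \<not> (\<exists>i. (i, j + 1) \<in> skew_diagram lam \<xi>)}"

type_synonym ratfun = "rat poly fract"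

definition q :: ratfun where
  "q = Fract [:0, 1:] 1"

text \<open>Polynomials in indeterminates indexed by the naturals; indeterminate \<open>k\<close> is the power sum
  \<open>p\<^bsub>2k+1\<^esub>\<close>. A monomial \<open>m\<close> is thus \<open>p\<^sub>\<lambda>\<close> for the odd partition \<open>\<lambda>\<close> in which the part
  \<open>2k+1\<close> has multiplicity \<open>m k\<close>.\<close>

type_synonym gamma = "(nat \<Rightarrow>\<^sub>0 nat) \<Rightarrow>\<^sub>0 ratfun"

definition scal :: "ratfun \<Rightarrow> gamma" where
  "scal c = Poly_Mapping.single 0 c"

text \<open>Only meaningful for odd \<open>n = 2k+1\<close>, where \<open>n div 2 = k\<close>; likewise for \<open>psum_deriv\<close>.\<close>

definition psum :: "nat \<Rightarrow> gamma" where
  "psum n = Poly_Mapping.single (Poly_Mapping.single (n div 2) 1) 1"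

definition psum_deriv :: "nat \<Rightarrow> gamma \<Rightarrow> gamma" where
  "psum_deriv n f = (\<Sum>m\<in>Poly_Mapping.keys f.
     Poly_Mapping.single (m - Poly_Mapping.single (n div 2) 1)
       (of_nat (Poly_Mapping.lookup m (n div 2)) * Poly_Mapping.lookup f m))"

definition mon_len :: "(nat \<Rightarrow>\<^sub>0 nat) \<Rightarrow> nat" where
  "mon_len m = (\<Sum>k\<in>Poly_Mapping.keys m. Poly_Mapping.lookup m k)"

definition mon_z :: "(nat \<Rightarrow>\<^sub>0 nat) \<Rightarrow> nat" where
  "mon_z m = (\<Prod>k\<in>Poly_Mapping.keys m.
     (2 * k + 1) ^ Poly_Mapping.lookup m k * fact (Poly_Mapping.lookup m k))"

text \<open>The bilinear extension of \<open>\<langle>p\<^sub>\<lambda>, p\<^sub>\<mu>\<rangle> = 2^(-l(\<lambda>)) z\<^sub>\<lambda> \<delta>\<^bsub>\<lambda>\<mu>\<^esub>\<close>.\<close>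

definition form :: "gamma \<Rightarrow> gamma \<Rightarrow> ratfun" where
  "form f g = (\<Sum>m\<in>Poly_Mapping.keys f \<inter> Poly_Mapping.keys g.
     Poly_Mapping.lookup f m * Poly_Mapping.lookup g m * (of_nat (mon_z m) / 2 ^ mon_len m))"

text \<open>The exponential \<open>\<Sum>k. T^k F / k!\<close> of a linear operator \<open>T\<close> on power series over \<open>\<Gamma>\<close> that
  raises the order of a series by at least one, so that only \<open>k \<le> m\<close> contributes to the
  \<open>m\<close>-th coefficient.\<close>

definition op_exp :: "(gamma fps \<Rightarrow> gamma fps) \<Rightarrow> gamma fps \<Rightarrow> gamma fps" where
  "op_exp T F = Abs_fps (\<lambda>m. \<Sum>k\<le>m. scal (1 / fact k) * fps_nth ((T ^^ k) F) m)"

definition series_exp :: "gamma fps \<Rightarrow> gamma fps" where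
  "series_exp A = op_exp (\<lambda>F. A * F) 1"

definition creation :: "gamma fps" where
  "creation = series_exp (Abs_fps (\<lambda>n. if odd n then scal (2 / of_nat n) * psum n else 0))"

text \<open>The operator \<open>- \<Sum>n odd. w^n \<partial>/\<partial>p\<^sub>n\<close> on power series in \<open>w\<close>, where \<open>w\<close> stands for the
  inverse of \<open>z\<close>; applied below to constant series.\<close>

definition deriv_op :: "gamma fps \<Rightarrow> gamma fps" where
  "deriv_op F = Abs_fps (\<lambda>m. - (\<Sum>n | odd n \<and> n \<le> m. psum_deriv n (fps_nth F (m - n))))"

definition annihilation :: "gamma \<Rightarrow> gamma fps" where
  "annihilation f = op_exp deriv_op (fps_const f)"

text \<open>The coefficient of \<open>z^n\<close>: the term with \<open>z^(n+m)\<close> from the first factor and \<open>z^(-m)\<close> from the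
  second. The sum has finite support, as \<open>annihilation f\<close> has only finitely many nonzero
  coefficients.\<close>

definition Qop :: "int \<Rightarrow> gamma \<Rightarrow> gamma" where
  "Qop n f = Sum_any (\<lambda>m::nat.
     (if 0 \<le> n + int m then fps_nth creation (nat (n + int m)) else 0) * fps_nth (annihilation f) m)"

definition Qfun :: "nat list \<Rightarrow> gamma" where
  "Qfun lam = foldr (\<lambda>k. Qop (int k)) lam 1"

definition g_series :: "gamma fps" where
  "g_series = series_exp
     (Abs_fps (\<lambda>n. if odd n then scal (2 * (q ^ n - 1) / of_nat n) * psum n else 0))"

definition gfun :: "nat list \<Rightarrow> gamma" where
  "gfun \<mu> = prod_list (map (fps_nth g_series) \<mu>)"

text \<open>The irreducible character values, given by the Frobenius formula solved for its
  coefficients.\<close>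

definition zeta :: "nat list \<Rightarrow> nat list \<Rightarrow> ratfun" where
  "zeta lam \<mu> = 2 powi (- int (eps lam)) * (q - 1) powi (- int (num_parts \<mu>)) * form (gfun \<mu>) (Qfun lam)"

definition qnum :: "nat \<Rightarrow> ratfun" where
  "qnum k = (if k = 0 then 1 else (q ^ k - (- 1) ^ k) / (q + 1))"

definition qnum_comp :: "nat list \<Rightarrow> ratfun" where
  "qnum_comp \<tau> = prod_list (map qnum \<tau>)"

end

theory Submission
  imports Defs
begin

text \<open>Let \<open>transl k f\<close> be the coefficient of \<open>u^k\<close> in the image of \<open>f\<close> under the ring homomorphism
  \<open>p\<^sub>n \<mapsto> p\<^sub>n + u^n\<close>. It is adjoint to multiplication by \<open>h\<^sub>k\<close>, the coefficient of \<open>z^k\<close> in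
  \<open>exp (\<Sum>n odd. 2/n p\<^sub>n z^n)\<close>, and the annihilation part of \<open>Q(z)\<close> has coefficients
  \<open>(- 1)^m transl m\<close>. Hence \<open>\<langle>g, Q\<^sub>x f\<rangle> = \<Sum>m. (- 1)^m \<langle>transl (x + m) g, transl m f\<rangle>\<close>.

  The translation multiplies the series of the \<open>g\<^sub>n\<close> by
  \<open>(1 + qzu) (1 - zu) / ((1 - qzu) (1 + zu)) = 1 + 2 (q - 1) \<Sum>k>0. (k)\<^sub>q (zu)^k\<close>, which gives the sum
  over \<open>\<tau>\<close>. On \<open>Q\<^sub>\<lambda>\<close> it acts by the adjoint of the Pieri rule, which gives the strips: moving it past
  \<open>Q\<^sub>x\<close> produces \<open>Q\<^sub>x + 2u Q\<^bsub>x-1\<^esub> + 2u^2 Q\<^bsub>x-2\<^esub> + \<dots>\<close>, and since \<open>Q\<^sub>y Q\<^sub>y = 0\<close> for \<open>y > 0\<close>, this series can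
  be cut off at \<open>Q\<^sub>y\<close>, with half the coefficient, in front of a further factor \<open>Q\<^sub>y\<close>.\<close>

section \<open>Power sums, their derivatives and the form\<close>

text \<open>Characteristic 0 lets the recursions below divide by \<open>of_nat n\<close>, by
  factorials and by 2 in the coefficient field.\<close>

instance fract :: ("{idom, ring_char_0}") field_char_0
proof
  show "inj (of_nat :: nat \<Rightarrow> 'a fract)"
    by (auto intro!: injI simp: of_nat_fract eq_fract)
qed

text \<open>Reduces linear identities to monomials. It serves also for the exponents, which are
  finitely supported maps themselves.\<close>

lemma poly_mapping_additive_induct [case_names zero add single]:
  assumes "P 0" and "\<And>f g. P f \<Longrightarrow> P g \<Longrightarrow> P (f + g)" and "\<And>m c. P (Poly_Mapping.single m c)"
  shows "P (f :: 'a \<Rightarrow>\<^sub>0 'b::comm_monoid_add)"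
proof (induction f rule: update_induct)
  case const show ?case by (rule assms)
next
  case (update f a b)
  have "Poly_Mapping.update a b f = f + Poly_Mapping.single a b"
    using update(1) by (intro poly_mapping_eqI) (auto simp: lookup_update lookup_add lookup_single in_keys_iff)
  then show ?case using assms(2)[OF update(3) assms(3)] by simp
qed

lemma scal_0 [simp]: "scal 0 = 0" and scal_1 [simp]: "scal 1 = 1"
  and scal_of_nat [simp]: "scal (of_nat n) = of_nat n"
  and scal_add: "scal (a + b) = scal a + scal b"
  and scal_minus: "scal (- a) = - scal a"
  and scal_mult: "scal (a * b) = scal a * scal b"
  by (simp_all add: scal_def single_add single_uminus mult_single)

lemma scal_numeral [simp]: "scal (numeral k) = numeral k"
  by (simp add: scal_def)

lemma scal_sum: "scal (sum f A) = (\<Sum>x\<in>A. scal (f x))"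
  by (induction A rule: infinite_finite_induct) (simp_all add: scal_add)

lemma scal_power: "scal (a ^ k) = scal a ^ k"
  by (induction k) (simp_all add: scal_mult)

lemma lookup_scal_times: "Poly_Mapping.lookup (scal c * f) m = c * Poly_Mapping.lookup f m"
proof (induction f rule: poly_mapping_additive_induct)
  case (single m' d)
  then show ?case by (auto simp: scal_def mult_single lookup_single when_def)
qed (auto simp: distrib_left lookup_add)

lemma lookup_times_scal: "Poly_Mapping.lookup (f * scal c) m = c * Poly_Mapping.lookup f m"
  using lookup_scal_times[of c f m] by (simp add: mult.commute)

text \<open>\<open>gamma\<close> is only a ring, so the inverse of \<open>n\<close> is taken from
  its scalars. This extracts single coefficients from recursions of logarithmic derivative
  type.\<close>

lemma of_nat_times_cancel:
  assumes "of_nat n * (x::gamma) = of_nat n * y" and "n > 0"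
  shows "x = y"
proof -
  have "scal (1 / of_nat n) * (of_nat n * z) = z" for z
    using \<open>n > 0\<close> by (simp flip: scal_of_nat scal_mult add: mult.assoc [symmetric])
  then show ?thesis using assms(1) by metis
qed

lemma psum_deriv_lookup:
  "Poly_Mapping.lookup (psum_deriv n f) m
    = of_nat (Poly_Mapping.lookup m (n div 2) + 1) * Poly_Mapping.lookup f (m + Poly_Mapping.single (n div 2) 1)"
proof -
  let ?e = "Poly_Mapping.single (n div 2) (1::nat)"
  have "Poly_Mapping.lookup (psum_deriv n f) m = (\<Sum>m'\<in>Poly_Mapping.keys f.
      if m' = m + ?e then of_nat (Poly_Mapping.lookup m' (n div 2)) * Poly_Mapping.lookup f m' else 0)"
    unfolding psum_deriv_def lookup_sum
  proof (rule sum.cong)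
    fix m' assume "m' \<in> Poly_Mapping.keys f"
    show "Poly_Mapping.lookup (Poly_Mapping.single (m' - ?e) (of_nat (Poly_Mapping.lookup m' (n div 2)) * Poly_Mapping.lookup f m')) m
      = (if m' = m + ?e then of_nat (Poly_Mapping.lookup m' (n div 2)) * Poly_Mapping.lookup f m' else 0)"
    \<comment> \<open>If the exponent is 0, the truncated difference \<open>m' - ?e\<close> does not
      determine \<open>m'\<close>, but then both sides are 0.\<close>
    proof (cases "Poly_Mapping.lookup m' (n div 2) = 0")
      case False
      then have "m' - ?e = m \<longleftrightarrow> m' = m + ?e"
        by (auto simp: poly_mapping_eq_iff fun_eq_iff lookup_minus lookup_add lookup_single when_def)
      then show ?thesis by (simp add: lookup_single when_def)
    qed auto
  qed simp
  also have "\<dots> = of_nat (Poly_Mapping.lookup m (n div 2) + 1) * Poly_Mapping.lookup f (m + ?e)"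
    by (auto simp: sum.delta lookup_add in_keys_iff)
  finally show ?thesis .
qed

lemma psum_deriv_add: "psum_deriv n (f + g) = psum_deriv n f + psum_deriv n g"
  by (intro poly_mapping_eqI) (simp add: psum_deriv_lookup lookup_add algebra_simps)

lemma psum_deriv_0 [simp]: "psum_deriv n 0 = 0"
  by (simp add: psum_deriv_def)

lemma psum_deriv_scal_times: "psum_deriv n (scal c * f) = scal c * psum_deriv n f"
  by (intro poly_mapping_eqI) (simp add: psum_deriv_lookup lookup_scal_times lookup_times_scal algebra_simps)

lemma psum_deriv_commute: "psum_deriv n (psum_deriv k f) = psum_deriv k (psum_deriv n f)"
  by (intro poly_mapping_eqI)
    (auto simp: psum_deriv_lookup lookup_add lookup_single when_def algebra_simps)

lemma psum_deriv_single: "psum_deriv n (Poly_Mapping.single m c)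
    = Poly_Mapping.single (m - Poly_Mapping.single (n div 2) 1) (of_nat (Poly_Mapping.lookup m (n div 2)) * c)"
  by (simp add: psum_deriv_def)

lemma psum_deriv_mult: "psum_deriv n (f * g) = psum_deriv n f * g + f * psum_deriv n g"
proof (induction f rule: poly_mapping_additive_induct)
  case (single m c)
  show ?case
  proof (induction g rule: poly_mapping_additive_induct)
    case (single m' d)
    let ?e = "Poly_Mapping.single (n div 2) (1::nat)"
    let ?l = "\<lambda>m. Poly_Mapping.lookup m (n div 2)"
    have *: "m - ?e + m' = m + m' - ?e" if "?l m > 0" for m m' :: "nat \<Rightarrow>\<^sub>0 nat"
      using that by (intro poly_mapping_eqI) (auto simp: lookup_minus lookup_add lookup_single when_def)
    have 1: "psum_deriv n (Poly_Mapping.single m c) * Poly_Mapping.single m' d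
        = Poly_Mapping.single (m + m' - ?e) (of_nat (?l m) * (c * d))" for m m' :: "nat \<Rightarrow>\<^sub>0 nat" and c d
      by (cases "?l m = 0") (simp_all add: psum_deriv_single mult_single *[of m m', unfolded One_nat_def] mult.assoc)
    have "psum_deriv n (Poly_Mapping.single m c) * Poly_Mapping.single m' d
        + Poly_Mapping.single m c * psum_deriv n (Poly_Mapping.single m' d)
        = Poly_Mapping.single (m + m' - ?e) (of_nat (?l m) * (c * d) + of_nat (?l m') * (c * d))"
      using 1[of m c m' d] 1[of m' d m c] by (simp add: mult.commute add.commute single_add)
    then show ?case
      by (simp add: mult_single psum_deriv_single lookup_add algebra_simps)
  qed (auto simp: algebra_simps psum_deriv_add)
qed (auto simp: algebra_simps psum_deriv_add)

lemma psum_deriv_psum: "odd n \<Longrightarrow> odd k \<Longrightarrow> psum_deriv n (psum k) = (if n = k then 1 else 0)"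
  by (auto simp: psum_def psum_deriv_single lookup_single when_def elim!: oddE simp flip: single_one)

section \<open>The bilinear form and the adjoint of a power sum\<close>

lemma form_sym: "form f g = form g f"
  unfolding form_def by (rule sum.cong) (auto simp: mult_ac)

text \<open>The range of summation in \<open>form\<close> changes with its arguments; over a common
  finite superset, bilinearity becomes a termwise identity.\<close>

lemma form_superset:
  assumes "finite S" "Poly_Mapping.keys f \<inter> Poly_Mapping.keys g \<subseteq> S"
  shows "form f g = (\<Sum>m\<in>S. Poly_Mapping.lookup f m * Poly_Mapping.lookup g m * (of_nat (mon_z m) / 2 ^ mon_len m))"
  unfolding form_def by (rule sum.mono_neutral_left) (use assms in \<open>auto simp: in_keys_iff\<close>)

lemma form_add_left: "form (f + g) h = form f h + form g h"
  by (subst (1 2 3) form_superset[of "Poly_Mapping.keys h"]) (auto simp: lookup_add algebra_simps sum.distrib)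

lemma form_scal_left: "form (scal c * f) g = c * form f g"
  by (subst (1 2) form_superset[of "Poly_Mapping.keys g"]) (auto simp: lookup_scal_times lookup_times_scal sum_distrib_left mult_ac)

lemma form_0_left [simp]: "form 0 g = 0"
  by (simp add: form_def)

lemma form_of_nat_left: "form (of_nat c * f) g = of_nat c * form f g"
  using form_scal_left[of "of_nat c"] by simp

lemma form_sum_left: "form (sum f A) g = (\<Sum>x\<in>A. form (f x) g)"
  by (induction A rule: infinite_finite_induct) (simp_all add: form_add_left)

lemma form_single: "form (Poly_Mapping.single m c) g
    = c * Poly_Mapping.lookup g m * (of_nat (mon_z m) / 2 ^ mon_len m)"
  by (subst form_superset[of "{m}"]) auto

lemma mon_len_add_single: "mon_len (m + Poly_Mapping.single k 1) = mon_len m + 1"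
proof -
  have keys: "Poly_Mapping.keys (m + Poly_Mapping.single k 1) = insert k (Poly_Mapping.keys m)"
    by (auto simp: in_keys_iff lookup_add lookup_single when_def split: if_splits)
  have "(\<Sum>i\<in>insert k (Poly_Mapping.keys m). Poly_Mapping.lookup m i) = mon_len m"
    unfolding mon_len_def by (rule sum.mono_neutral_right) (auto simp: in_keys_iff)
  then show ?thesis
    unfolding mon_len_def keys by (simp add: lookup_add lookup_single sum.distrib when_def)
qed

lemma mon_z_add_single:
  "mon_z (m + Poly_Mapping.single k 1) = (2 * k + 1) * (Poly_Mapping.lookup m k + 1) * mon_z m"
proof -
  have keys: "Poly_Mapping.keys (m + Poly_Mapping.single k 1) = insert k (Poly_Mapping.keys m)"
    by (auto simp: in_keys_iff lookup_add lookup_single when_def split: if_splits)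
  let ?t = "\<lambda>m i. (2 * i + 1) ^ Poly_Mapping.lookup m i * fact (Poly_Mapping.lookup m i) :: nat"
  have 1: "mon_z m = (\<Prod>i\<in>insert k (Poly_Mapping.keys m). ?t m i)"
    unfolding mon_z_def by (rule prod.mono_neutral_left) (auto simp: in_keys_iff)
  have 2: "(\<Prod>i\<in>Poly_Mapping.keys m - {k}. ?t (m + Poly_Mapping.single k 1) i) = (\<Prod>i\<in>Poly_Mapping.keys m - {k}. ?t m i)"
    by (rule prod.cong) (auto simp: lookup_add lookup_single when_def)
  have 3: "?t (m + Poly_Mapping.single k 1) k = (2 * k + 1) * (Poly_Mapping.lookup m k + 1) * ?t m k"
    by (simp add: lookup_add algebra_simps)
  show ?thesis
    unfolding 1 unfolding mon_z_def keys
    by (simp only: prod.insert_remove[OF finite_keys] 2 3 mult.assoc)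
qed

text \<open>One more part \<open>n\<close> multiplies the value of the form on a monomial by
  \<open>n / 2\<close> times the new multiplicity of \<open>n\<close>, and this multiplicity is what
  differentiation produces.\<close>

lemma form_psum_times:
  assumes "odd n"
  shows "form (psum n * f) g = of_nat n / 2 * form f (psum_deriv n g)"
proof (induction f rule: poly_mapping_additive_induct)
  case (single m c)
  from assms have "(of_nat n :: ratfun) = of_nat (2 * (n div 2) + 1)" by simp
  then show ?case
    by (simp add: psum_def mult_single form_single psum_deriv_lookup mon_len_add_single[unfolded One_nat_def]
      mon_z_add_single[unfolded One_nat_def] field_simps add.commute[of "Poly_Mapping.single _ _"])
qed (auto simp: algebra_simps form_add_left)

section \<open>Translation of the power sums\<close>

lemma sum_triangle_swap:
  fixes f :: "nat \<Rightarrow> nat \<Rightarrow> 'a::comm_monoid_add"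
  shows "(\<Sum>j\<le>n. \<Sum>i\<le>n - j. f i j) = (\<Sum>j\<le>n. \<Sum>i\<le>n - j. f j i)"
  unfolding sum.Sigma[OF finite_atMost ballI[OF finite_atMost]]
  by (rule sum.reindex_bij_witness[of _ prod.swap prod.swap]) auto

text \<open>For T = \<Sum>j. L_j u^j with commuting L_j, this is the coefficient form of u d/du
  exp(T) = (u dT/du) exp(T). It covers both exponentials in use: multiplication by a series and a
  series of derivations.\<close>

lemma op_exp_const:
  fixes L :: "nat \<Rightarrow> gamma \<Rightarrow> gamma"
  assumes L_add: "\<And>j f g. L j (f + g) = L j f + L j g"
    and L_scal: "\<And>j c f. L j (scal c * f) = scal c * L j f"
    and L_commute: "\<And>i j f. L i (L j f) = L j (L i f)"
    and L_0: "\<And>f. L 0 f = 0"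
    and T: "\<And>F n. fps_nth (T F) n = (\<Sum>j\<le>n. L j (fps_nth F (n - j)))"
  shows op_exp_const_nth_0: "fps_nth (op_exp T (fps_const f)) 0 = f"
    and op_exp_const_rec: "of_nat n * fps_nth (op_exp T (fps_const f)) n
      = (\<Sum>j\<le>n. of_nat j * L j (fps_nth (op_exp T (fps_const f)) (n - j)))"
proof -
  have L_zero [simp]: "L j 0 = 0" for j using L_scal[of j 0 0] by simp
  have L_of_nat: "L j (of_nat k * g) = of_nat k * L j g" for j k g
    using L_scal[of j "of_nat k" g] by simp
  have L_sum: "L j (sum h S) = (\<Sum>x\<in>S. L j (h x))" for j S and h :: "nat \<Rightarrow> gamma"
    by (induction S rule: infinite_finite_induct) (simp_all add: L_add)
  define a where "a k n = fps_nth ((T ^^ k) (fps_const f)) n" for k n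
  define X where "X n = fps_nth (op_exp T (fps_const f)) n" for n
  have a_0: "a 0 n = (if n = 0 then f else 0)" for n by (simp add: a_def)
  have a_Suc: "a (Suc k) n = (\<Sum>j\<le>n. L j (a k (n - j)))" for k n by (simp add: a_def T)
  have a_vanish: "n < k \<Longrightarrow> a k n = 0" for k n
  proof (induction k arbitrary: n)
    case (Suc k)
    \<comment> \<open>As \<open>L 0\<close> is zero, each application of \<open>T\<close> raises the
      order by at least one.\<close>
    have "L j (a k (n - j)) = 0" if "j \<le> n" for j
      using Suc that by (cases "j = 0") (auto simp: L_0)
    then show ?case by (simp add: a_Suc)
  qed simp
  \<comment> \<open>The Euler operator u d/du applied to a power of T gives (k + 1) (u dT/du)
    T^k.\<close>
  have a_rec: "of_nat n * a (Suc k) n = of_nat (Suc k) * (\<Sum>j\<le>n. of_nat j * L j (a k (n - j)))" for k n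
  proof (induction k arbitrary: n)
    case 0
    have "(\<Sum>j\<le>n. of_nat j * L j (a 0 (n - j))) = of_nat n * L n f"
      by (subst sum.remove[of _ n]) (auto intro!: sum.neutral simp: a_0)
    moreover have "a (Suc 0) n = L n f"
      unfolding a_Suc by (subst sum.remove[of _ n]) (auto intro!: sum.neutral simp: a_0)
    ultimately show ?case by simp
  next
    case (Suc k)
    let ?S = "\<Sum>j\<le>n. of_nat j * L j (a (Suc k) (n - j))"
    \<comment> \<open>Splitting \<open>n\<close> into \<open>j\<close> and \<open>n - j\<close> is
      the product rule: one part differentiates the outermost factor, the other the inner
      power.\<close>
    have "of_nat n * a (Suc (Suc k)) n = (\<Sum>j\<le>n. of_nat (j + (n - j)) * L j (a (Suc k) (n - j)))"
      unfolding a_Suc[of "Suc k"] sum_distrib_left by (intro sum.cong) auto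
    also have "\<dots> = ?S + (\<Sum>j\<le>n. L j (of_nat (n - j) * a (Suc k) (n - j)))"
      by (simp only: of_nat_add distrib_right sum.distrib L_of_nat)
    also have "(\<Sum>j\<le>n. L j (of_nat (n - j) * a (Suc k) (n - j)))
        = of_nat (Suc k) * (\<Sum>j\<le>n. \<Sum>i\<le>n - j. of_nat i * L j (L i (a k (n - j - i))))"
      unfolding Suc.IH L_of_nat L_sum sum_distrib_left ..
    also have "(\<Sum>j\<le>n. \<Sum>i\<le>n - j. of_nat i * L j (L i (a k (n - j - i)))) =
        (\<Sum>j\<le>n. \<Sum>i\<le>n - j. of_nat j * L i (L j (a k (n - i - j))))"
      by (rule sum_triangle_swap)
    also have "\<dots> = ?S"
      unfolding a_Suc L_sum sum_distrib_left
      by (intro sum.cong refl) (simp add: L_commute add.commute)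
    finally show ?case by (simp add: algebra_simps)
  qed
  \<comment> \<open>Terms with \<open>k > n\<close> vanish, so coefficients of different degrees can
    share one range of summation.\<close>
  have X: "X n = (\<Sum>k\<le>N. scal (1 / fact k) * a k n)" if "n \<le> N" for n N
    unfolding X_def op_exp_def fps_nth_Abs_fps a_def[symmetric]
    by (rule sum.mono_neutral_left) (use that a_vanish in auto)
  show "fps_nth (op_exp T (fps_const f)) 0 = f"
    using X[of 0 0] by (simp add: X_def a_0)
  show "of_nat n * fps_nth (op_exp T (fps_const f)) n
      = (\<Sum>j\<le>n. of_nat j * L j (fps_nth (op_exp T (fps_const f)) (n - j)))"
  proof (cases n)
    case (Suc n')
    have "scal (1 / fact (Suc k)) * (of_nat (Suc k) * y) = scal (1 / fact k) * y" for k y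
      by (simp flip: scal_of_nat scal_mult mult.assoc del: of_nat_Suc)
    note cancel = this
    have split: "(\<Sum>k\<le>n. h k) = h 0 + (\<Sum>k\<le>n'. h (Suc k))" for h :: "nat \<Rightarrow> gamma"
      by (simp add: Suc sum.atMost_Suc_shift del: sum.atMost_Suc)
    have "n \<noteq> 0" using Suc by simp
    have "of_nat n * X n = (\<Sum>k\<le>n. scal (1 / fact k) * (of_nat n * a k n))"
      by (simp add: X[of n n] sum_distrib_left mult_ac)
    also have "\<dots> = (\<Sum>k\<le>n'. scal (1 / fact k) * (\<Sum>j\<le>n. of_nat j * L j (a k (n - j))))"
      using \<open>n \<noteq> 0\<close>
      by (subst split[where h = "\<lambda>k. scal (1 / fact k) * (of_nat n * a k n)"])
        (simp add: a_0 a_rec cancel del: fact_Suc of_nat_Suc)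
    also have "\<dots> = (\<Sum>j\<le>n. of_nat j * L j (\<Sum>k\<le>n'. scal (1 / fact k) * a k (n - j)))"
      unfolding L_sum sum_distrib_left by (subst sum.swap) (simp add: L_scal mult_ac)
    also have "\<dots> = (\<Sum>j\<le>n. of_nat j * L j (X (n - j)))"
    \<comment> \<open>For \<open>j = 0\<close> the factor \<open>of_nat j\<close> is 0; for all
      other \<open>j\<close> the degree \<open>n - j\<close> is at most \<open>n'\<close>, so the
      shorter range suffices.\<close>
    proof (rule sum.cong)
      fix j assume "j \<in> {..n}"
      then show "of_nat j * L j (\<Sum>k\<le>n'. scal (1 / fact k) * a k (n - j)) = of_nat j * L j (X (n - j))"
        using X[of "n - j" n'] Suc by (cases "j = 0") auto
    qed simp
    finally show ?thesis by (simp add: X_def)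
  qed simp
qed

definition odd_deriv :: "nat \<Rightarrow> gamma \<Rightarrow> gamma" where
  "odd_deriv n f = (if odd n then psum_deriv n f else 0)"

text \<open>The coefficient of \<open>u^n\<close> in the image of \<open>f\<close> under the substitution \<open>p\<^sub>k \<mapsto> p\<^sub>k + u^k\<close>. The
  sign turns \<open>w\<close> into \<open>- u\<close>, which matches because only odd powers occur in the exponent.\<close>

definition transl :: "nat \<Rightarrow> gamma \<Rightarrow> gamma" where
  "transl n f = (- 1) ^ n * fps_nth (annihilation f) n"

lemma odd_deriv_add: "odd_deriv n (f + g) = odd_deriv n f + odd_deriv n g"
  and odd_deriv_scal_times: "odd_deriv n (scal c * f) = scal c * odd_deriv n f"
  and odd_deriv_commute: "odd_deriv n (odd_deriv k f) = odd_deriv k (odd_deriv n f)"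
  and odd_deriv_mult: "odd_deriv n (f * g) = odd_deriv n f * g + f * odd_deriv n g"
  by (simp_all add: odd_deriv_def psum_deriv_add psum_deriv_scal_times psum_deriv_commute[of k])
    (simp add: psum_deriv_mult)

lemma odd_deriv_0 [simp]: "odd_deriv n 0 = 0"
  by (simp add: odd_deriv_def)

lemma odd_deriv_1 [simp]: "odd_deriv n 1 = 0"
  using odd_deriv_mult[of n 1 1] by simp

lemma odd_deriv_of_nat_times: "odd_deriv n (of_nat c * f) = of_nat c * odd_deriv n f"
  using odd_deriv_scal_times[of n "of_nat c"] by simp

lemma odd_deriv_uminus: "odd_deriv n (- f) = - odd_deriv n f"
  using odd_deriv_add[of n f "- f"] by (simp add: eq_neg_iff_add_eq_0 add.commute)

lemma odd_deriv_sign_times: "odd_deriv n ((- 1) ^ k * f) = (- 1) ^ k * odd_deriv n f"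
  by (cases "even k") (simp_all add: odd_deriv_uminus)

lemma odd_deriv_sum: "odd_deriv n (sum f S) = (\<Sum>x\<in>S. odd_deriv n (f x))"
  by (induction S rule: infinite_finite_induct) (simp_all add: odd_deriv_add)

lemma transl_0 [simp]: "transl 0 f = f"
  and transl_rec: "of_nat n * transl n f = (\<Sum>j\<le>n. of_nat j * odd_deriv j (transl (n - j) f))"
proof -
  have op: "fps_nth (deriv_op F) n = (\<Sum>j\<le>n. - odd_deriv j (fps_nth F (n - j)))" for F n
    unfolding deriv_op_def fps_nth_Abs_fps sum_negf
    by (subst sum.mono_neutral_right[of "{..n}" "{j. odd j \<and> j \<le> n}"])
      (auto simp: odd_deriv_def intro!: sum.cong)
  note exp = op_exp_const[where L = "\<lambda>j f. - odd_deriv j f" and T = deriv_op and f = f, OF _ _ _ _ op]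
  show "transl 0 f = f"
    unfolding transl_def annihilation_def
    by (subst exp(1)) (auto simp: odd_deriv_add odd_deriv_scal_times odd_deriv_uminus
        intro: odd_deriv_commute simp: odd_deriv_def[of 0])
  have rec: "of_nat n * fps_nth (annihilation f) n
      = (\<Sum>j\<le>n. of_nat j * - odd_deriv j (fps_nth (annihilation f) (n - j)))"
    unfolding annihilation_def
    by (subst exp(2)) (auto simp: odd_deriv_add odd_deriv_scal_times odd_deriv_uminus
        intro: odd_deriv_commute simp: odd_deriv_def[of 0])
  have "of_nat n * transl n f = (- 1) ^ n * (of_nat n * fps_nth (annihilation f) n)"
    by (simp add: transl_def mult_ac)
  also have "\<dots> = (\<Sum>j\<le>n. of_nat j * odd_deriv j (transl (n - j) f))"
    unfolding rec sum_distrib_left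
  proof (rule sum.cong)
    fix j assume "j \<in> {..n}"
    show "(- 1) ^ n * (of_nat j * - odd_deriv j (fps_nth (annihilation f) (n - j)))
        = of_nat j * odd_deriv j (transl (n - j) f)"
    \<comment> \<open>Only odd \<open>j\<close> contribute, and for these the change of sign from
      \<open>n\<close> to \<open>n - j\<close> cancels the minus sign of
      \<open>deriv_op\<close>.\<close>
    proof (cases "odd j")
      case True
      with \<open>j \<in> {..n}\<close> have sign: "(- 1 :: gamma) ^ n = - ((- 1) ^ (n - j))"
        by (cases "even n") auto
      show ?thesis
        unfolding transl_def odd_deriv_sign_times sign by (simp add: mult.left_commute)
    qed (simp add: odd_deriv_def)
  qed simp
  finally show "of_nat n * transl n f = (\<Sum>j\<le>n. of_nat j * odd_deriv j (transl (n - j) f))" .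
qed

lemma annihilation_nth: "fps_nth (annihilation f) n = (- 1) ^ n * transl n f"
  by (simp add: transl_def flip: mult.assoc power_add)

text \<open>The term \<open>j = 0\<close> has factor 0, so the recursion expresses
  \<open>X n\<close> through earlier coefficients. The algebraic properties of \<open>transl\<close>
  follow by checking this recursion.\<close>

lemma transl_unique:
  assumes "\<And>n. n > 0 \<Longrightarrow> of_nat n * X n = (\<Sum>j\<le>n. of_nat j * odd_deriv j (X (n - j)))"
  shows "X n = transl n (X 0)"
proof (induction n rule: less_induct)
  case (less n)
  show ?case
  proof (cases "n = 0")
    case False
    have "of_nat n * X n = of_nat n * transl n (X 0)"
      unfolding assms[OF neq0_conv[THEN iffD1, OF False]] transl_rec
    proof (rule sum.cong)
      fix j assume "j \<in> {..n}"
      then show "of_nat j * odd_deriv j (X (n - j)) = of_nat j * odd_deriv j (transl (n - j) (X 0))"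
        using False less[of "n - j"] by (cases "j = 0") auto
    qed simp
    then show ?thesis using False by (auto intro: of_nat_times_cancel)
  qed simp
qed

section \<open>Algebraic properties of the translation\<close>

lemma transl_add: "transl n (f + g) = transl n f + transl n g"
  by (rule transl_unique[of "\<lambda>n. transl n f + transl n g", simplified, symmetric])
    (simp add: distrib_left transl_rec odd_deriv_add sum.distrib)

lemma transl_scal_times: "transl n (scal c * f) = scal c * transl n f"
  by (rule transl_unique[of "\<lambda>n. scal c * transl n f", simplified, symmetric])
    (simp add: mult.left_commute[of _ "scal c"] transl_rec odd_deriv_scal_times sum_distrib_left)

lemma transl_zero [simp]: "transl n 0 = 0"
  using transl_scal_times[of n 0 0] by simp

lemma transl_of_nat_times: "transl n (of_nat c * f) = of_nat c * transl n f"
  using transl_scal_times[of n "of_nat c"] by simp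

lemma transl_sum: "transl n (sum f S) = (\<Sum>x\<in>S. transl n (f x))"
  by (induction S rule: infinite_finite_induct) (simp_all add: transl_add)

lemma transl_odd_deriv: "transl n (odd_deriv k f) = odd_deriv k (transl n f)"
  by (rule transl_unique[of "\<lambda>n. odd_deriv k (transl n f)", simplified, symmetric])
    (simp add: transl_rec odd_deriv_sum odd_deriv_commute[of _ k] flip: odd_deriv_of_nat_times)

lemma transl_commute: "transl n (transl k f) = transl k (transl n f)"
proof (rule transl_unique[of "\<lambda>n. transl k (transl n f)", simplified, symmetric])
  fix n :: nat
  have "of_nat n * transl k (transl n f) = transl k (of_nat n * transl n f)"
    by (simp add: transl_of_nat_times)
  also have "\<dots> = (\<Sum>j\<le>n. of_nat j * odd_deriv j (transl k (transl (n - j) f)))"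
    unfolding transl_rec by (simp add: transl_sum transl_odd_deriv transl_of_nat_times)
  finally show "of_nat n * transl k (transl n f) = (\<Sum>j\<le>n. of_nat j * odd_deriv j (transl k (transl (n - j) f)))" .
qed

text \<open>Since the operators \<open>odd_deriv j\<close> are derivations, the convolution of two
  solutions of the recursion is again a solution.\<close>

lemma transl_mult: "transl n (f * g) = (\<Sum>i\<le>n. transl i f * transl (n - i) g)"
proof -
  let ?X = "\<lambda>n. \<Sum>i\<le>n. transl i f * transl (n - i) g"
  have "?X n = transl n (?X 0)"
  proof (rule transl_unique)
  fix n :: nat
  \<comment> \<open>Writing \<open>n\<close> as \<open>i + (n - i)\<close> lets
    \<open>transl_rec\<close> act on one factor at a time.\<close>
  have "of_nat n * (\<Sum>i\<le>n. transl i f * transl (n - i) g)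
      = (\<Sum>i\<le>n. transl (n - i) g * (of_nat i * transl i f)) + (\<Sum>i\<le>n. transl i f * (of_nat (n - i) * transl (n - i) g))"
    unfolding sum_distrib_left sum.distrib[symmetric]
    by (intro sum.cong refl) (simp add: of_nat_diff algebra_simps)
  also have "(\<Sum>i\<le>n. transl (n - i) g * (of_nat i * transl i f))
      = (\<Sum>i\<le>n. transl i g * (of_nat (n - i) * transl (n - i) f))"
    by (rule sum.reindex_bij_witness[of _ "\<lambda>i. n - i" "\<lambda>i. n - i"]) auto
  also have "\<dots> = (\<Sum>i\<le>n. \<Sum>j\<le>n-i. of_nat j * transl i g * odd_deriv j (transl (n - i - j) f))"
    unfolding transl_rec sum_distrib_left by (simp add: mult_ac)
  also have "\<dots> = (\<Sum>j\<le>n. \<Sum>i\<le>n-j. of_nat j * transl i g * odd_deriv j (transl (n - i - j) f))"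
    by (rule sum_triangle_swap)
  also have "\<dots> = (\<Sum>j\<le>n. of_nat j * (\<Sum>i\<le>n-j. odd_deriv j (transl i f) * transl (n - j - i) g))"
  proof (rule sum.cong)
    fix j
    have "(\<Sum>i\<le>n-j. transl i g * odd_deriv j (transl (n - j - i) f))
       = (\<Sum>i\<le>n-j. odd_deriv j (transl i f) * transl (n - j - i) g)"
      by (rule sum.reindex_bij_witness[of _ "\<lambda>i. n - j - i" "\<lambda>i. n - j - i"]) (auto simp: mult.commute simp del: diff_diff_left)
    then show "(\<Sum>i\<le>n-j. of_nat j * transl i g * odd_deriv j (transl (n - i - j) f))
      = of_nat j * (\<Sum>i\<le>n-j. odd_deriv j (transl i f) * transl (n - j - i) g)"
      by (simp add: mult.assoc add.commute flip: sum_distrib_left)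
  qed simp
  also have "(\<Sum>i\<le>n. transl i f * (of_nat (n - i) * transl (n - i) g))
      = (\<Sum>i\<le>n. \<Sum>j\<le>n-i. of_nat j * transl i f * odd_deriv j (transl (n - i - j) g))"
    unfolding transl_rec sum_distrib_left by (simp add: mult_ac)
  also have "\<dots> = (\<Sum>j\<le>n. \<Sum>i\<le>n-j. of_nat j * transl i f * odd_deriv j (transl (n - i - j) g))"
    by (rule sum_triangle_swap)
  also have "\<dots> = (\<Sum>j\<le>n. of_nat j * (\<Sum>i\<le>n-j. transl i f * odd_deriv j (transl (n - j - i) g)))"
    by (simp add: sum_distrib_left mult.assoc add.commute)
  finally show "of_nat n * (\<Sum>i\<le>n. transl i f * transl (n - i) g)
      = (\<Sum>j\<le>n. of_nat j * odd_deriv j (\<Sum>i\<le>n - j. transl i f * transl (n - j - i) g))"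
    by (simp add: odd_deriv_sum odd_deriv_mult sum.distrib distrib_left)
  qed
  then show ?thesis by simp
qed

lemma transl_1: "transl n 1 = (if n = 0 then 1 else 0)"
  by (rule transl_unique[of "\<lambda>n. if n = 0 then 1 else 0", simplified, symmetric])
    (auto intro!: sum.neutral split: if_splits)

lemma transl_scal: "transl n (scal c) = (if n = 0 then scal c else 0)"
  using transl_scal_times[of n c 1] by (simp add: transl_1)

lemma transl_psum:
  assumes "odd k"
  shows "transl n (psum k) = (if n = 0 then psum k else if n = k then 1 else 0)"
proof -
  have D: "odd_deriv j (psum k) = (if j = k then 1 else 0)" for j
    using assms by (auto simp: odd_deriv_def psum_deriv_psum)
  let ?X = "\<lambda>n. if n = 0 then psum k else if n = k then 1 else 0"
  have "?X n = transl n (?X 0)"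
  proof (rule transl_unique)
    fix n :: nat assume "n > 0"
    have "(\<Sum>j\<le>n. of_nat j * odd_deriv j (if n - j = 0 then psum k else if n - j = k then 1 else 0))
       = of_nat n * odd_deriv n (psum k)"
      by (subst sum.remove[of _ n]) (auto intro!: sum.neutral split: if_splits)
    then show "of_nat n * (if n = 0 then psum k else if n = k then 1 else 0) =
         (\<Sum>j\<le>n. of_nat j * odd_deriv j (if n - j = 0 then psum k else if n - j = k then 1 else 0))"
      using \<open>n > 0\<close> by (simp add: D)
  qed
  then show ?thesis by simp
qed

lemma transl_eventually_0_mult:
  assumes "\<exists>N. \<forall>n\<ge>N. transl n f = 0" and "\<exists>N. \<forall>n\<ge>N. transl n g = 0"
  shows "\<exists>N. \<forall>n\<ge>N. transl n (f * g) = 0"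
proof -
  obtain M N where MN: "\<forall>n\<ge>M. transl n f = 0" "\<forall>n\<ge>N. transl n g = 0" using assms by blast
  have "transl n (f * g) = 0" if "n \<ge> M + N" for n
    unfolding transl_mult
  proof (intro sum.neutral ballI)
    fix i
    have "i \<ge> M \<or> n - i \<ge> N" using that by arith
    then show "transl i f * transl (n - i) g = 0" using MN by auto
  qed
  then show ?thesis by blast
qed

text \<open>The translate of a polynomial is a polynomial in u: this holds for constants and power
  sums, and degree bounds add under products. It makes the sum that defines \<open>Qop\<close>
  finite.\<close>

lemma transl_eventually_0: "\<exists>N. \<forall>n\<ge>N. transl n f = 0"
proof (induction f rule: poly_mapping_additive_induct)
  case (add f g)
  then obtain M N where "\<forall>n\<ge>M. transl n f = 0" "\<forall>n\<ge>N. transl n g = 0" by auto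
  then show ?case by (intro exI[of _ "max M N"]) (auto simp: transl_add)
next
  case (single m c)
  have one: "\<exists>N. \<forall>n\<ge>N. transl n (scal c) = 0" for c
    by (intro exI[of _ 1]) (auto simp: transl_scal)
  have "\<exists>N. \<forall>n\<ge>N. transl n (Poly_Mapping.single m (1::ratfun)) = 0"
  proof (induction m rule: poly_mapping_additive_induct)
    case zero
    show ?case using one[of 1] by simp
  next
    case (add m m')
    from transl_eventually_0_mult[OF this] show ?case by (simp add: mult_single)
  next
    case (single k e)
    show ?case
    proof (induction e)
      case 0
      show ?case using one[of 1] by simp
    next
      case (Suc e)
      have "\<exists>N. \<forall>n\<ge>N. transl n (psum (2 * k + 1)) = 0"
        by (intro exI[of _ "2 * k + 2"]) (auto simp: transl_psum)
      from transl_eventually_0_mult[OF this Suc] show ?case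
        by (simp add: psum_def mult_single flip: single_add)
    qed
  qed
  from transl_eventually_0_mult[OF one[of c] this] show ?case by (simp add: scal_def mult_single)
qed auto

section \<open>Translation of exponentials and of vertex operators\<close>

lemma scal_sign: "scal ((- 1) ^ m) = (- 1) ^ m"
  by (simp add: scal_power scal_minus)

lemma transl_sign_times: "transl n ((- 1) ^ m * f) = (- 1) ^ m * transl n f"
  using transl_scal_times[of n "(- 1) ^ m" f] by (simp add: scal_sign)

text \<open>Common form of \<open>creation\<close>, where \<open>b\<close> is constantly 2, and of
  \<open>g_series\<close>, where \<open>b n\<close> is \<open>2 * (q ^ n - 1)\<close>. The division
  by \<open>n\<close> leaves \<open>b n * p_n\<close> as coefficient of the logarithmic
  derivative.\<close>

definition odd_exp :: "(nat \<Rightarrow> ratfun) \<Rightarrow> gamma fps" where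
  "odd_exp b = series_exp (Abs_fps (\<lambda>n. if odd n then scal (b n / of_nat n) * psum n else 0))"

lemma odd_exp_nth_0 [simp]: "fps_nth (odd_exp b) 0 = 1"
  and odd_exp_rec: "of_nat n * fps_nth (odd_exp b) n
    = (\<Sum>j\<le>n. if odd j then scal (b j) * psum j * fps_nth (odd_exp b) (n - j) else 0)"
proof -
  define B :: "gamma fps" where
    "B = Abs_fps (\<lambda>n. if odd n then scal (b n / of_nat n) * psum n else 0)"
  have H: "odd_exp b = op_exp (\<lambda>F. B * F) (fps_const 1)"
    by (simp add: odd_exp_def series_exp_def B_def)
  note exp = op_exp_const[where L = "\<lambda>j f. fps_nth B j * f" and T = "\<lambda>F. B * F" and f = 1]
  show "fps_nth (odd_exp b) 0 = 1"
    unfolding H by (rule exp(1)) (simp_all add: distrib_left mult.left_commute fps_mult_nth atLeast0AtMost, simp add: B_def)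
  have "of_nat n * fps_nth (odd_exp b) n = (\<Sum>j\<le>n. of_nat j * (fps_nth B j * fps_nth (odd_exp b) (n - j)))"
    unfolding H by (rule exp(2)) (simp_all add: distrib_left mult.left_commute fps_mult_nth atLeast0AtMost, simp add: B_def)
  also have "\<dots> = (\<Sum>j\<le>n. if odd j then scal (b j) * psum j * fps_nth (odd_exp b) (n - j) else 0)"
  proof (rule sum.cong)
    fix j
    have "of_nat j * scal (b j / of_nat j) = scal (b j)" if "odd j"
      using that by (simp flip: scal_of_nat scal_mult add: odd_pos)
    then show "of_nat j * (fps_nth B j * fps_nth (odd_exp b) (n - j))
        = (if odd j then scal (b j) * psum j * fps_nth (odd_exp b) (n - j) else 0)"
      by (simp add: B_def flip: mult.assoc)
  qed simp
  finally show "of_nat n * fps_nth (odd_exp b) n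
    = (\<Sum>j\<le>n. if odd j then scal (b j) * psum j * fps_nth (odd_exp b) (n - j) else 0)" .
qed

lemma transl_psum_times:
  assumes "odd j"
  shows "transl k (psum j * f) = psum j * transl k f + (if j \<le> k then transl (k - j) f else 0)"
proof -
  have "j \<noteq> 0" using assms by (rule contrapos_pn) simp
  have "transl k (psum j * f) = (\<Sum>i\<le>k. (if i = 0 then psum j * transl k f else 0) + (if i = j then transl (k - j) f else 0))"
    unfolding transl_mult by (intro sum.cong) (use \<open>j \<noteq> 0\<close> in \<open>auto simp: transl_psum assms\<close>)
  then show ?thesis by (simp add: sum.distrib)
qed

text \<open>The recursion for \<open>s\<close> is the logarithmic derivative of
  \<open>\<Sum>k. s k x^k = exp (\<Sum>j odd. b j / j x^j)\<close>.\<close>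

lemma transl_odd_exp:
  fixes s :: "nat \<Rightarrow> ratfun"
  assumes s_0: "s 0 = 1"
    and s_rec: "\<And>k. of_nat k * s k = (\<Sum>j\<le>k. if odd j then b j * s (k - j) else 0)"
  shows "transl k (fps_nth (odd_exp b) n) = (if k \<le> n then scal (s k) * fps_nth (odd_exp b) (n - k) else 0)"
proof (induction n arbitrary: k rule: less_induct)
  case (less n)
  let ?G = "fps_nth (odd_exp b)"
  show ?case
  proof (cases "n = 0")
    case True
    then show ?thesis by (simp add: transl_1 s_0)
  next
    case False
    \<comment> \<open>\<open>?A\<close> keeps \<open>psum j\<close>, while \<open>?B\<close>
      replaces it by u^j. For \<open>k \<le> n\<close> the first sum yields the share
      \<open>n - k\<close> and the second the share \<open>k\<close> of the factor
      \<open>n\<close>.\<close>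
    let ?A = "\<lambda>j. if odd j then scal (b j) * psum j * transl k (?G (n - j)) else 0"
    let ?B = "\<lambda>j. if odd j \<and> j \<le> k then scal (b j) * transl (k - j) (?G (n - j)) else 0"
    have "of_nat n * transl k (?G n) = transl k (of_nat n * ?G n)"
      by (simp add: transl_of_nat_times)
    also have "\<dots> = (\<Sum>j\<le>n. ?A j + ?B j)"
      unfolding odd_exp_rec transl_sum
      by (intro sum.cong refl)
        (simp add: mult.assoc transl_scal_times transl_psum_times distrib_left)
    finally have main: "of_nat n * transl k (?G n) = sum ?A {..n} + sum ?B {..n}"
      by (simp add: sum.distrib)
    show ?thesis
    proof (cases "k \<le> n")
      case True
      have "sum ?A {..n} = (\<Sum>j\<le>n - k. if odd j then scal (b j) * psum j * (scal (s k) * ?G (n - k - j)) else 0)"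
      proof (rule sum.mono_neutral_cong_right)
        show "\<forall>j\<in>{..n} - {..n - k}. ?A j = 0"
        proof
          fix j assume "j \<in> {..n} - {..n - k}"
          then have "\<not> k \<le> n - j" and "n - j < n" by auto
          from less[OF this(2), of k] this(1) show "?A j = 0" by simp
        qed
        fix j assume "j \<in> {..n - k}"
        then show "?A j = (if odd j then scal (b j) * psum j * (scal (s k) * ?G (n - k - j)) else 0)"
          using less[of "n - j" k] True False by (cases "j = 0") (auto simp: add.commute[of k j])
      qed auto
      also have "\<dots> = scal (s k) * (of_nat (n - k) * ?G (n - k))"
        unfolding odd_exp_rec sum_distrib_left by (intro sum.cong) (auto simp: mult_ac)
      finally have A: "sum ?A {..n} = scal (s k) * (of_nat (n - k) * ?G (n - k))" .
      have "sum ?B {..n} = (\<Sum>j\<le>k. scal (if odd j then b j * s (k - j) else 0) * ?G (n - k))"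
      proof (rule sum.mono_neutral_cong_right)
        fix j assume "j \<in> {..k}"
        then show "?B j = scal (if odd j then b j * s (k - j) else 0) * ?G (n - k)"
          using less[of "n - j" "k - j"] True False by (cases "j = 0") (auto simp: scal_mult mult.assoc)
      qed (use True in auto)
      also have "\<dots> = scal (of_nat k * s k) * ?G (n - k)"
        by (simp only: s_rec scal_sum sum_distrib_right)
      finally have B: "sum ?B {..n} = scal (of_nat k * s k) * ?G (n - k)" .
      have n_eq: "(of_nat n :: gamma) = of_nat (n - k) + of_nat k"
        using True by (simp flip: of_nat_add)
      have "of_nat n * transl k (?G n) = of_nat n * (scal (s k) * ?G (n - k))"
        unfolding main A B scal_mult scal_of_nat unfolding n_eq by (simp only: ring_distribs mult_ac)
      from of_nat_times_cancel[OF this] True False show ?thesis by simp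
    next
      case kn: False
      have "?A j = 0" "?B j = 0" if "j \<le> n" for j
      proof -
        have "n - j < n \<and> \<not> k \<le> n - j \<and> \<not> k - j \<le> n - j" if "odd j"
          using \<open>j \<le> n\<close> kn False odd_pos[OF that] by auto
        then show "?A j = 0" "?B j = 0"
          using less[of "n - j" k] less[of "n - j" "k - j"] by auto
      qed
      then have "of_nat n * transl k (?G n) = of_nat n * 0"
        unfolding main by simp
      from of_nat_times_cancel[OF this] kn False show ?thesis by simp
    qed
  qed
qed

lemma creation_eq: "creation = odd_exp (\<lambda>_. 2)"
  by (simp add: creation_def odd_exp_def)

text \<open>The coefficients 2/n in \<open>creation\<close> cancel the factor n/2 of
  \<open>form_psum_times\<close>, so the recursions of \<open>creation\<close> and of
  \<open>transl\<close> are adjoint term by term.\<close>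

lemma form_creation_times: "form (fps_nth creation k * f) g = form f (transl k g)"
proof (induction k arbitrary: f g rule: less_induct)
  case (less k)
  show ?case
  proof (cases "k = 0")
    case True
    then show ?thesis by (simp add: creation_eq)
  next
    case False
    have "of_nat k * form (fps_nth creation k * f) g = form ((of_nat k * fps_nth creation k) * f) g"
      by (simp add: form_of_nat_left mult.assoc)
    also have "\<dots> = (\<Sum>j\<le>k. form (of_nat j * f) (transl (k - j) (odd_deriv j g)))"
      unfolding creation_eq odd_exp_rec sum_distrib_right form_sum_left
    proof (rule sum.cong)
      fix j assume "j \<in> {..k}"
      show "form ((if odd j then scal 2 * psum j * fps_nth (odd_exp (\<lambda>_. 2)) (k - j) else 0) * f) g
          = form (of_nat j * f) (transl (k - j) (odd_deriv j g))"
      proof (cases "odd j")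
        case True
        then have "form (fps_nth creation (k - j) * f) (psum_deriv j g) = form f (transl (k - j) (psum_deriv j g))"
          using False by (intro less) (auto simp: odd_pos)
        then show ?thesis using True
          by (simp add: mult.assoc form_scal_left form_psum_times odd_deriv_def form_of_nat_left
              creation_eq del: scal_numeral)
      next
        case False
        then show ?thesis by (simp add: odd_deriv_def form_sym[of _ 0])
      qed
    qed simp
    also have "\<dots> = of_nat k * form f (transl k g)"
    proof -
      have "of_nat k * form f (transl k g) = form (of_nat k * transl k g) f"
        by (simp add: form_of_nat_left form_sym[of f])
      then show ?thesis
        unfolding transl_rec form_sum_left
        by (simp add: form_of_nat_left transl_odd_deriv form_sym[of f])
    qed
    finally show ?thesis using False by simp
  qed
qed

text \<open>Being zero at negative indices, it equals \<open>Qop z 1\<close> for every integer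
  \<open>z\<close>, and shifts of the index need no case distinction.\<close>

definition one_row :: "int \<Rightarrow> gamma" where
  "one_row z = (if 0 \<le> z then fps_nth creation (nat z) else 0)"

text \<open>Coefficients of (1 + x) / (1 - x) = exp (\<Sum>j odd. 2/j x^j).\<close>

definition weight :: "nat \<Rightarrow> gamma" where
  "weight k = (if k = 0 then 1 else 2)"

lemma weight_scal: "weight k = scal (if k = 0 then 1 else 2)"
  by (simp add: weight_def)

lemma transl_one_row: "transl k (one_row z) = weight k * one_row (z - int k)"
proof -
  let ?c = "\<lambda>k. if k = 0 then 1 else 2 :: ratfun"
  \<comment> \<open>This is the recursion that \<open>transl_odd_exp\<close> asks for. Only odd
    \<open>j\<close> count, so the induction moves by two.\<close>
  have "of_nat k * ?c k = (\<Sum>j\<le>k. if odd j then 2 * ?c (k - j) else 0)" for k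
  proof (induction k rule: induct_nat_012)
    case (ge2 k)
    have "(\<Sum>j\<le>Suc (Suc k). if odd j then 2 * ?c (Suc (Suc k) - j) else 0)
        = 4 + (\<Sum>j\<le>k. if odd j then 2 * ?c (k - j) else 0)"
      by (simp add: sum.atMost_Suc_shift Suc_diff_Suc del: sum.atMost_Suc cong: if_cong)
    then show ?case unfolding ge2(1)[symmetric] by (cases k) (simp_all add: algebra_simps)
  qed (simp_all add: lessThan_Suc)
  from transl_odd_exp[of ?c "\<lambda>_. 2", OF _ this]
  have "transl k (fps_nth creation n) = (if k \<le> n then weight k * fps_nth creation (n - k) else 0)" for n
    by (simp add: creation_eq weight_scal)
  then show ?thesis
    by (auto simp: one_row_def nat_diff_distrib)
qed

section \<open>Vertex operators and their translates\<close>

lemma Qop_eq_sum: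
  assumes "\<And>m. m \<ge> N \<Longrightarrow> transl m f = 0"
  shows "Qop n f = (\<Sum>m<N. one_row (n + int m) * ((- 1) ^ m * transl m f))"
proof -
  have "Qop n f = Sum_any (\<lambda>m. one_row (n + int m) * ((- 1) ^ m * transl m f))"
    by (simp add: Qop_def one_row_def annihilation_nth)
  also have "\<dots> = (\<Sum>m<N. one_row (n + int m) * ((- 1) ^ m * transl m f))"
    by (rule Sum_any.expand_superset) (use assms in \<open>auto simp: not_less[symmetric]\<close>)
  finally show ?thesis .
qed

lemma Qop_add: "Qop n (f + g) = Qop n f + Qop n g"
proof -
  obtain M N where "\<forall>m\<ge>M. transl m f = 0" "\<forall>m\<ge>N. transl m g = 0"
    using transl_eventually_0 by metis
  then show ?thesis
    by (subst (1 2 3) Qop_eq_sum[of "max M N"]) (auto simp: transl_add algebra_simps sum.distrib)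
qed

lemma Qop_scal_times: "Qop n (scal c * f) = scal c * Qop n f"
proof -
  obtain N where "\<forall>m\<ge>N. transl m f = 0" using transl_eventually_0 by metis
  then show ?thesis
    by (subst (1 2) Qop_eq_sum[of N]) (simp_all add: transl_scal_times mult.left_commute[of _ "scal c"] sum_distrib_left)
qed

lemma Qop_0 [simp]: "Qop n 0 = 0"
  using Qop_scal_times[of n 0 0] by simp

lemma Qop_sum: "Qop n (sum f S) = (\<Sum>x\<in>S. Qop n (f x))"
  by (induction S rule: infinite_finite_induct) (simp_all add: Qop_add)

lemma Qop_1: "Qop n 1 = one_row n"
  by (subst Qop_eq_sum[of 1]) (auto simp: transl_1)

text \<open>The annihilation part consists of translations and commutes with
  \<open>transl k\<close>; the creation part is multiplied by (1 + zu) / (1 - zu), whose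
  coefficients are the weights.\<close>

lemma transl_Qop: "transl k (Qop n f) = (\<Sum>i\<le>k. weight i * Qop (n - int i) (transl (k - i) f))"
proof -
  obtain N where N: "\<And>m. m \<ge> N \<Longrightarrow> transl m f = 0" using transl_eventually_0 by metis
  have N': "transl m (transl i f) = 0" if "m \<ge> N" for m i
    using that N by (simp add: transl_commute[of m])
  have "transl k (Qop n f) = (\<Sum>m<N. \<Sum>i\<le>k. transl i (one_row (n + int m)) * ((- 1) ^ m * transl (k - i) (transl m f)))"
    by (subst Qop_eq_sum[OF N]) (simp_all add: transl_sum transl_mult[of k] transl_sign_times)
  also have "\<dots> = (\<Sum>i\<le>k. \<Sum>m<N. weight i * (one_row (n - int i + int m) * ((- 1) ^ m * transl m (transl (k - i) f))))"
    by (subst sum.swap) (simp add: transl_one_row transl_commute[of _ "_ - _"] mult.assoc algebra_simps)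
  also have "\<dots> = (\<Sum>i\<le>k. weight i * Qop (n - int i) (transl (k - i) f))"
    by (intro sum.cong refl) (simp add: Qop_eq_sum[OF N'] sum_distrib_left)
  finally show ?thesis .
qed

lemma form_Qop:
  assumes "\<And>m. m \<ge> N \<Longrightarrow> transl m f = 0"
  shows "form g (Qop (int x) f) = (\<Sum>m<N. (- 1) ^ m * form (transl (x + m) g) (transl m f))"
proof -
  have "form g (Qop (int x) f) = (\<Sum>m<N. form (scal ((- 1) ^ m) * (fps_nth creation (x + m) * transl m f)) g)"
    by (subst form_sym, subst Qop_eq_sum[OF assms])
      (simp_all add: form_sum_left one_row_def nat_add_distrib scal_sign mult.left_commute)
  also have "\<dots> = (\<Sum>m<N. (- 1) ^ m * form (transl (x + m) g) (transl m f))"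
    unfolding form_scal_left form_creation_times by (subst form_sym) simp
  finally show ?thesis .
qed

section \<open>Squares of vertex operators\<close>

text \<open>The generating function \<open>h\<close> of \<open>creation\<close> satisfies \<open>h(z) h(-z) = 1\<close>, because the
  logarithmic derivatives of the two factors cancel.\<close>

lemma creation_alternating_convolution:
  assumes "n > 0"
  shows "(\<Sum>r\<le>n. (- 1) ^ r * (fps_nth creation r * fps_nth creation (n - r))) = 0"
proof -
  define H' where "H' = Abs_fps (\<lambda>n. (- 1) ^ n * fps_nth creation n)"
  define P :: "gamma fps" where "P = Abs_fps (\<lambda>j. if odd j then 2 * psum j else 0)"
  have theta: "fps_nth (fps_X * fps_deriv F) n = of_nat n * fps_nth F n" for F :: "gamma fps" and n
    by (cases n) auto
  have H: "fps_X * fps_deriv creation = P * creation"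
    by (intro fps_ext, unfold theta, unfold creation_eq odd_exp_rec fps_mult_nth atLeast0AtMost)
      (auto simp: P_def intro: sum.cong)
  \<comment> \<open>\<open>H'\<close> is h(-z). As \<open>P\<close> has odd powers only, replacing z
    by -z changes its sign.\<close>
  have "fps_X * fps_deriv H' = - (P * H')"
  proof (intro fps_ext)
    fix n
    have "fps_nth (fps_X * fps_deriv H') n = (- 1) ^ n * (of_nat n * fps_nth creation n)"
      unfolding theta by (simp add: H'_def mult.left_commute)
    also have "\<dots> = fps_nth (- (P * H')) n"
      unfolding creation_eq odd_exp_rec fps_neg_nth fps_mult_nth atLeast0AtMost sum_distrib_left sum_negf[symmetric]
    proof (rule sum.cong)
      fix j assume "j \<in> {..n}"
      then have "(- 1 :: gamma) ^ n = - ((- 1) ^ (n - j))" if "odd j"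
        using that by (cases "even n") auto
      then show "(- 1) ^ n * (if odd j then scal 2 * psum j * fps_nth (odd_exp (\<lambda>_. 2)) (n - j) else 0)
          = - (fps_nth P j * fps_nth H' (n - j))"
        by (simp add: P_def H'_def creation_eq mult_ac)
    qed simp
    finally show "fps_nth (fps_X * fps_deriv H') n = fps_nth (- (P * H')) n" .
  qed
  then have "fps_X * fps_deriv (H' * creation) = 0"
    using H by (simp add: algebra_simps)
  then have "of_nat n * fps_nth (H' * creation) n = 0"
    using theta[of "H' * creation" n] by simp
  then have "fps_nth (H' * creation) n = 0"
    using of_nat_times_cancel[of n "fps_nth (H' * creation) n" 0] assms by simp
  then show ?thesis
    by (simp add: fps_mult_nth H'_def atLeast0AtMost mult.assoc)
qed

lemma weighted_sum: "(\<Sum>i\<le>n. weight i * F i) = 2 * (\<Sum>i\<le>n. F i) - F 0"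
  by (induction n) (auto simp: weight_def algebra_simps)

text \<open>Without weights, the two sums are the parts \<open>r \<ge> a\<close> and
  \<open>r \<le> a\<close> of the vanishing alternating convolution, up to a common sign. Doubled,
  they leave twice the shared term \<open>r = a\<close>, which the weight 1 at \<open>i = 0\<close>
  in each sum removes.\<close>

lemma creation_straighten:
  assumes "a + b > 0"
  shows "(\<Sum>i\<le>b. weight i * ((- 1) ^ i * (fps_nth creation (a + i) * fps_nth creation (b - i))))
    + (\<Sum>i\<le>a. weight i * ((- 1) ^ i * (fps_nth creation (b + i) * fps_nth creation (a - i)))) = 0"
proof -
  define t where "t r = (- 1) ^ r * (fps_nth creation r * fps_nth creation (a + b - r))" for r
  have 1: "(\<Sum>i\<le>b. (- 1) ^ i * (fps_nth creation (a + i) * fps_nth creation (b - i))) = (- 1) ^ a * sum t {a..a+b}"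
    unfolding sum_distrib_left
    by (rule sum.reindex_bij_witness[of _ "\<lambda>r. r - a" "\<lambda>i. a + i"]) (auto simp: t_def power_add)
  have 2: "(\<Sum>i\<le>a. (- 1) ^ i * (fps_nth creation (b + i) * fps_nth creation (a - i))) = (- 1) ^ a * sum t {..a}"
    unfolding sum_distrib_left
  proof (rule sum.reindex_bij_witness[of _ "\<lambda>r. a - r" "\<lambda>i. a - i"])
    fix i assume i: "i \<in> {..a}"
    then have "(- 1 :: gamma) ^ a * (- 1) ^ (a - i) = (- 1) ^ i"
      by (cases "even a"; cases "even i") auto
    then show "(- 1) ^ a * t (a - i) = (- 1) ^ i * (fps_nth creation (b + i) * fps_nth creation (a - i))"
      using i by (simp add: t_def mult_ac flip: mult.assoc[of "(- 1) ^ a" "(- 1) ^ (a - i)"])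
  qed auto
  have "sum t {..a+b} = 0"
    using creation_alternating_convolution[OF assms] by (simp add: t_def)
  moreover have "sum t {..a+b} + t a = sum t {..a} + sum t {a..a+b}"
  proof -
    have "{..a+b} = {..a} \<union> {Suc a..a+b}" by auto
    then have "sum t {..a+b} = sum t {..a} + sum t {Suc a..a+b}"
      by (simp add: sum.union_disjoint)
    then show ?thesis by (simp add: sum.atLeast_Suc_atMost[of a "a + b"] algebra_simps)
  qed
  ultimately have t: "sum t {..a} + sum t {a..a+b} = t a" by simp
  have "(- 1) ^ a * t a = fps_nth creation a * fps_nth creation b"
    by (simp add: t_def flip: mult.assoc power_add)
  then have "2 * ((- 1) ^ a * sum t {a..a+b}) + 2 * ((- 1) ^ a * sum t {..a})
      = 2 * (fps_nth creation a * fps_nth creation b)"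
    using arg_cong[OF t, of "\<lambda>x. 2 * ((- 1) ^ a * x)"] by (simp add: algebra_simps)
  then show ?thesis
    unfolding weighted_sum 1 2 by (simp add: algebra_simps)
qed

text \<open>Regrouping by r = i + s; the bound on \<open>R\<close> puts the whole support inside the
  triangle.\<close>

lemma sum_triangle:
  fixes F :: "nat \<Rightarrow> nat \<Rightarrow> 'a::comm_monoid_add"
  assumes "\<And>i s. i \<ge> I \<or> s \<ge> N \<Longrightarrow> F i s = 0" and "I + N \<le> R"
  shows "(\<Sum>r<R. \<Sum>i\<le>r. F i (r - i)) = (\<Sum>s<N. \<Sum>i<I. F i s)"
proof -
  have "(\<Sum>r<R. \<Sum>i\<le>r. F i (r - i)) = (\<Sum>(r, i)\<in>(SIGMA r:{..<R}. {..r}). F i (r - i))"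
    by (simp add: sum.Sigma)
  also have "\<dots> = (\<Sum>(s, i)\<in>{(s, i). i + s < R}. F i s)"
    by (rule sum.reindex_bij_witness[of _ "\<lambda>(s, i). (i + s, i)" "\<lambda>(r, i). (r - i, i)"]) auto
  also have "\<dots> = (\<Sum>(s, i)\<in>{..<N} \<times> {..<I}. F i s)"
  proof (rule sum.mono_neutral_right)
    have "{(s, i). i + s < R} \<subseteq> {..<R} \<times> {..<R}" by auto
    then show "finite {(s, i). i + s < R}" by (rule finite_subset) simp
    show "\<forall>p\<in>{(s, i). i + s < R} - {..<N} \<times> {..<I}. (case p of (s, i) \<Rightarrow> F i s) = 0"
    proof
      fix p assume "p \<in> {(s, i). i + s < R} - {..<N} \<times> {..<I}"
      then have "snd p \<ge> I \<or> fst p \<ge> N" by (auto simp: not_less split: prod.splits)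
      from assms(1)[OF this] show "(case p of (s, i) \<Rightarrow> F i s) = 0" by (simp add: split_beta)
    qed
  qed (use assms(2) in auto)
  also have "\<dots> = (\<Sum>s<N. \<Sum>i<I. F i s)"
    by (simp add: sum.cartesian_product)
  finally show ?thesis .
qed

lemma one_row_int: "one_row (int a) = fps_nth creation a"
  by (simp add: one_row_def)

lemma one_row_diff: "one_row (int a - int i) = (if i \<le> a then fps_nth creation (a - i) else 0)"
  by (auto simp: one_row_def nat_diff_distrib)

text \<open>Expanding both operators gives a sum over pairs (s, l) of double translates of
  \<open>f\<close>. The translates are symmetric in s and l, their coefficients antisymmetric by
  \<open>creation_straighten\<close>.\<close>

lemma Qop_Qop_same:
  assumes "x > 0"
  shows "Qop (int x) (Qop (int x) f) = 0"
proof -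
  obtain N where N: "\<And>m. m \<ge> N \<Longrightarrow> transl m f = 0" using transl_eventually_0 by metis
  have N': "transl m (transl i f) = 0" if "m \<ge> N" for m i
    using that N by (simp add: transl_commute[of m])
  obtain R0 where R0: "\<And>m. m \<ge> R0 \<Longrightarrow> transl m (Qop (int x) f) = 0"
    using transl_eventually_0 by metis
  \<comment> \<open>Large enough for the outer translates to vanish and for
    \<open>sum_triangle\<close> with sides \<open>x + N\<close> and \<open>N\<close>.\<close>
  define R where "R = max R0 (x + N + N)"
  have R: "transl m (Qop (int x) f) = 0" if "m \<ge> R" for m
    using that R0 by (simp add: R_def)
  define K where "K a b = (\<Sum>i\<le>b. weight i * ((- 1) ^ i * (fps_nth creation (a + i) * fps_nth creation (b - i))))" for a b
  define G where "G s l = (- 1) ^ (s + l) * transl l (transl s f) * K (x + s) (x + l)" for s l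
  \<comment> \<open>Of the r = i + s units of translation, \<open>i\<close> fall on the inner
    operator and \<open>s\<close> on \<open>f\<close>; \<open>l\<close> is the annihilation index of
    the inner operator.\<close>
  define F where "F i s = (\<Sum>l<N. (- 1) ^ (s + l) * transl l (transl s f) *
      (weight i * ((- 1) ^ i * (one_row (int (x + s + i)) * one_row (int (x + l) - int i)))))" for i s
  have "Qop (int x) (Qop (int x) f)
      = (\<Sum>r<R. one_row (int x + int r) * ((- 1) ^ r * transl r (Qop (int x) f)))"
    by (rule Qop_eq_sum[OF R])
  also have "\<dots> = (\<Sum>r<R. \<Sum>i\<le>r. F i (r - i))"
  proof (rule sum.cong)
    fix r
    have "one_row (int x + int r) * ((- 1) ^ r * (weight i * Qop (int x - int i) (transl (r - i) f))) = F i (r - i)"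
      if "i \<le> r" for i
    proof -
      have sign: "(- 1 :: gamma) ^ r = (- 1) ^ (r - i) * (- 1) ^ i"
        using that by (simp flip: power_add)
      have Q: "Qop (int x - int i) (transl (r - i) f)
          = (\<Sum>l<N. one_row (int x - int i + int l) * ((- 1) ^ l * transl l (transl (r - i) f)))"
        by (rule Qop_eq_sum[OF N'])
      have "int x - int i + int l = int (x + l) - int i" "int x + int r = int (x + (r - i) + i)" for l
        using that by auto
      then show ?thesis
        unfolding F_def Q sign sum_distrib_left
        by (intro sum.cong refl) (simp only: power_add mult_ac)
    qed
    then show "one_row (int x + int r) * ((- 1) ^ r * transl r (Qop (int x) f)) = (\<Sum>i\<le>r. F i (r - i))"
      unfolding transl_Qop sum_distrib_left by (intro sum.cong) auto
  qed simp
  also have "\<dots> = (\<Sum>s<N. \<Sum>i<x + N. F i s)"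
  proof (rule sum_triangle[where F = F and I = "x + N" and N = N and R = R])
    \<comment> \<open>For \<open>l < N\<close>, any \<open>i \<ge> x + N\<close> makes the index of
      the second \<open>one_row\<close> negative.\<close>
    fix i s assume "x + N \<le> i \<or> N \<le> s"
    then show "F i s = 0"
      unfolding F_def by (intro sum.neutral) (auto simp: one_row_def N)
  qed (simp add: R_def)
  also have "\<dots> = (\<Sum>s<N. \<Sum>l<N. G s l)"
  proof (rule sum.cong)
    fix s
    have "K (x + s) (x + l) = (\<Sum>i<x + N. weight i * ((- 1) ^ i * (one_row (int (x + s + i)) * one_row (int (x + l) - int i))))"
      if "l < N" for l
      unfolding K_def
      unfolding one_row_diff one_row_int by (rule sum.mono_neutral_cong_left) (use that in auto)
    then show "(\<Sum>i<x + N. F i s) = (\<Sum>l<N. G s l)"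
      unfolding F_def G_def by (subst sum.swap) (simp add: sum_distrib_left)
  qed simp
  finally have main: "Qop (int x) (Qop (int x) f) = (\<Sum>s<N. \<Sum>l<N. G s l)" .
  have "G s l + G l s = 0" for s l
  proof -
    have "K (x + s) (x + l) + K (x + l) (x + s) = 0"
      unfolding K_def by (rule creation_straighten) (use assms in simp)
    then have "K (x + l) (x + s) = - K (x + s) (x + l)" by (simp add: eq_neg_iff_add_eq_0 add.commute)
    then show ?thesis by (simp add: G_def transl_commute[of s l] add.commute)
  qed
  then have "(\<Sum>s<N. \<Sum>l<N. G s l + G l s) = 0" by simp
  moreover have "(\<Sum>s<N. \<Sum>l<N. G s l + G l s) = (\<Sum>s<N. \<Sum>l<N. G s l) + (\<Sum>s<N. \<Sum>l<N. G s l)"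
    by (subst (3) sum.swap) (simp add: sum.distrib)
  ultimately have "of_nat 2 * (\<Sum>s<N. \<Sum>l<N. G s l) = of_nat 2 * 0" by simp
  then show ?thesis unfolding main by (rule of_nat_times_cancel) simp
qed

text \<open>Up to half of its last term, the tail of the expansion of \<open>transl k (Q\<^sub>x f)\<close> that starts
  with \<open>Q\<^sub>y\<close> is \<open>transl (k + y - x) (Q\<^sub>y f)\<close>, and this vanishes for \<open>f\<close> in the image of \<open>Q\<^sub>y\<close>.\<close>

lemma transl_Qop_Qop:
  assumes "y < x" and "0 < y"
  shows "transl k (Qop (int x) (Qop (int y) f)) = (\<Sum>d\<le>min k (x - y).
    (if d = 0 \<or> d = x - y then 1 else 2) * Qop (int x - int d) (transl (k - d) (Qop (int y) f)))"
proof -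
  define D where "D = x - y"
  have "D > 0" and D: "int x = int D + int y" using assms by (auto simp: D_def)
  define T where "T i = Qop (int x - int i) (transl (k - i) (Qop (int y) f))" for i
  define v :: "nat \<Rightarrow> gamma" where "v d = (if d = 0 \<or> d = D then 1 else 2)" for d
  have "(\<Sum>i\<le>k. weight i * T i) = (\<Sum>d\<le>min k D. v d * T d)"
  proof (cases "k < D")
    case True
    then show ?thesis by (intro sum.cong) (auto simp: weight_def v_def)
  next
    case False
    have "(\<Sum>i\<le>k - D. weight i * T (D + i)) = transl (k - D) (Qop (int y) (Qop (int y) f))"
      unfolding transl_Qop[of "k - D"] by (intro sum.cong) (auto simp: T_def D)
    also have "\<dots> = 0" using Qop_Qop_same[OF \<open>0 < y\<close>] by simp
    also have "(\<Sum>i\<le>k - D. weight i * T (D + i)) = (\<Sum>i\<in>{D..k}. weight (i - D) * T i)"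
      using False by (intro sum.reindex_bij_witness[of _ "\<lambda>i. i - D" "\<lambda>i. D + i"]) auto
    also have "\<dots> = (\<Sum>i\<le>k. if i \<ge> D then weight (i - D) * T i else 0)"
      by (rule sum.mono_neutral_cong_left) auto
    finally have "(\<Sum>i\<le>k. weight i * T i)
        = (\<Sum>i\<le>k. weight i * T i - (if i \<ge> D then weight (i - D) * T i else 0))"
      by (simp add: sum_subtractf)
    \<comment> \<open>Since \<open>D > 0\<close>, the weight at \<open>D\<close> is 2 and drops to 2
      - 1 = 1; beyond \<open>D\<close> the difference is 2 - 2 = 0.\<close>
    also have "\<dots> = (\<Sum>d\<le>D. v d * T d)"
      using False \<open>D > 0\<close> by (intro sum.mono_neutral_cong_right) (auto simp: weight_def v_def)
    finally show ?thesis using False by simp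
  qed
  then show ?thesis unfolding transl_Qop[of k] by (simp add: T_def v_def D_def)
qed

section \<open>Horizontal strips and the adjoint Pieri rule\<close>

definition strips :: "nat \<Rightarrow> nat list \<Rightarrow> nat list set" where
  "strips r lam = {\<xi>. (\<exists>k. \<xi> \<in> SP k) \<and> diag_subset \<xi> lam \<and> horizontal_strip r lam \<xi>}"

lemma SP_iff: "(\<exists>k. \<xi> \<in> SP k) \<longleftrightarrow> sorted_wrt (>) \<xi> \<and> 0 \<notin> set \<xi>"
  by (auto simp: SP_def)

lemma part_Nil [simp]: "part [] i = 0"
  and part_Cons_0 [simp]: "part (x # L) 0 = x"
  and part_Cons_Suc [simp]: "part (x # L) (Suc i) = part L i"
  by (simp_all add: part_def)

lemma part_le_part_0: "sorted_wrt (>) L \<Longrightarrow> part L i \<le> part L 0"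
  by (cases L; cases i) (auto simp: part_def less_imp_le)

lemma sorted_Cons_iff:
  "0 < z \<Longrightarrow> sorted_wrt (>) (z # M) \<longleftrightarrow> sorted_wrt (>) M \<and> part M 0 < z"
  by (cases M) auto

lemma diag_subset_Cons: "diag_subset (z # M) (x # L) \<longleftrightarrow> z \<le> x \<and> diag_subset M L"
proof -
  have "(\<forall>i. P i) \<longleftrightarrow> P 0 \<and> (\<forall>i. P (Suc i))" for P :: "nat \<Rightarrow> bool"
    by (metis not0_implies_Suc)
  from this[of "\<lambda>i. part (z # M) i \<le> part (x # L) i"] show ?thesis
    unfolding diag_subset_def by simp
qed

lemma skew_diagram_Cons:
  "skew_diagram (x # L) (z # M) = Pair 0 ` {z<..x} \<union> map_prod Suc id ` skew_diagram L M"
proof (intro set_eqI)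
  fix p :: "nat \<times> nat"
  obtain i j where p: "p = (i, j)" by fastforce
  show "p \<in> skew_diagram (x # L) (z # M) \<longleftrightarrow> p \<in> Pair 0 ` {z<..x} \<union> map_prod Suc id ` skew_diagram L M"
    unfolding p by (cases i) (force simp: skew_diagram_def)+
qed

lemma skew_diagram_column_le: "sorted_wrt (>) L \<Longrightarrow> (i, j) \<in> skew_diagram L M \<Longrightarrow> j \<le> part L 0"
  using part_le_part_0[of L i] by (simp add: skew_diagram_def)

lemma skew_diagram_Nil [simp]: "skew_diagram [] \<xi> = {}"
  by (auto simp: skew_diagram_def)

lemma finite_skew_diagram:
  assumes "sorted_wrt (>) L"
  shows "finite (skew_diagram L M)"
proof (rule finite_subset)
  show "skew_diagram L M \<subseteq> {..length L} \<times> {..part L 0}"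
  proof
    fix p assume p: "p \<in> skew_diagram L M"
    obtain i j where ij: "p = (i, j)" by fastforce
    have "i \<le> length L" using p by (auto simp: ij skew_diagram_def part_def split: if_splits)
    then show "p \<in> {..length L} \<times> {..part L 0}"
      using skew_diagram_column_le[OF assms] p ij by auto
  qed
qed simp

text \<open>The first row has its boxes in columns beyond \<open>z\<close>, the lower rows in
  columns up to \<open>part L 0 \<le> z\<close>. No column is shared, so the strip condition
  splits.\<close>

lemma horizontal_strip_Cons:
  assumes "sorted_wrt (>) L" and "part L 0 \<le> z"
  shows "horizontal_strip r (x # L) (z # M) \<longleftrightarrow> x - z \<le> r \<and> horizontal_strip (r - (x - z)) L M"
proof -
  have "card (skew_diagram (x # L) (z # M)) = card (Pair (0::nat) ` {z<..x}) + card (map_prod Suc (id :: nat \<Rightarrow> nat) ` skew_diagram L M)"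
    unfolding skew_diagram_Cons
    by (rule card_Un_disjoint) (use finite_skew_diagram[OF assms(1)] in auto)
  also have "\<dots> = x - z + card (skew_diagram L M)"
    by (subst (1 2) card_image) (auto simp: inj_on_def map_prod_def)
  finally have card: "card (skew_diagram (x # L) (z # M)) = x - z + card (skew_diagram L M)" .
  have le: "j \<le> z" if "(i, j) \<in> skew_diagram L M" for i j
    using skew_diagram_column_le[OF assms(1) that] assms(2) by simp
  have mem_0: "(0, j) \<in> skew_diagram (x # L) (z # M) \<longleftrightarrow> z < j \<and> j \<le> x"
    and mem_Suc: "(Suc i, j) \<in> skew_diagram (x # L) (z # M) \<longleftrightarrow> (i, j) \<in> skew_diagram L M" for i j
    by (simp_all add: skew_diagram_def)
  have "(\<forall>i i' j. (i, j) \<in> skew_diagram (x # L) (z # M) \<longrightarrow> (i', j) \<in> skew_diagram (x # L) (z # M) \<longrightarrow> i = i')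
     \<longleftrightarrow> (\<forall>i i' j. (i, j) \<in> skew_diagram L M \<longrightarrow> (i', j) \<in> skew_diagram L M \<longrightarrow> i = i')"
    (is "?P \<longleftrightarrow> ?Q")
  proof (intro iffI allI impI)
    fix i i' j
    assume ?P and "(i, j) \<in> skew_diagram L M" "(i', j) \<in> skew_diagram L M"
    then show "i = i'" using mem_Suc by blast
  next
    fix i i' j
    assume ?Q and "(i, j) \<in> skew_diagram (x # L) (z # M)" "(i', j) \<in> skew_diagram (x # L) (z # M)"
    then show "i = i'"
      using le[of "i - 1" j] le[of "i' - 1" j]
      by (cases i; cases i') (simp_all add: mem_0 mem_Suc)
  qed
  then show ?thesis
    unfolding horizontal_strip_def card by auto
qed

text \<open>Otherwise column \<open>y\<close> would contain boxes of both the first and the second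
  row, because \<open>\<xi>\<close> is decreasing.\<close>

lemma horizontal_strip_second_row:
  assumes "horizontal_strip r (x # y # L) \<xi>" and "sorted_wrt (>) \<xi>" and "0 < y" and "y < x" and "0 \<notin> set \<xi>"
  shows "y \<le> part \<xi> 0"
proof (rule ccontr)
  assume *: "\<not> y \<le> part \<xi> 0"
  then have "part \<xi> (Suc 0) < y" using part_le_part_0[OF assms(2), of "Suc 0"] by simp
  with * assms(4) have "(0, y) \<in> skew_diagram (x # y # L) \<xi>" "(Suc 0, y) \<in> skew_diagram (x # y # L) \<xi>"
    by (auto simp: skew_diagram_def)
  with assms(1) show False unfolding horizontal_strip_def by blast
qed

lemma diag_subset_Nil: "0 \<notin> set \<xi> \<Longrightarrow> diag_subset \<xi> [] \<longleftrightarrow> \<xi> = []"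
proof (cases \<xi>)
  case (Cons a M)
  moreover assume "0 \<notin> set \<xi>"
  ultimately have "\<not> part \<xi> 0 \<le> part [] 0" by simp
  then show ?thesis using Cons unfolding diag_subset_def by blast
qed (simp add: diag_subset_def)

lemma strips_Nil: "strips r [] = (if r = 0 then {[]} else {})"
proof -
  have "\<xi> \<in> strips r [] \<longleftrightarrow> \<xi> = [] \<and> r = 0" for \<xi>
    using diag_subset_Nil[of \<xi>] by (auto simp: strips_def SP_iff horizontal_strip_def)
  then show ?thesis by auto
qed

lemma skew_diagram_singleton_Nil: "skew_diagram [x] [] = Pair 0 ` {0<..x}"
  by (auto simp: skew_diagram_def part_def split: if_splits)

lemma strips_singleton:
  assumes "0 < x"
  shows "strips r [x] = (if r < x then {[x - r]} else if r = x then {[]} else {})"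
proof -
  have Nil: "[] \<in> strips r [x] \<longleftrightarrow> r = x"
    by (auto simp: strips_def horizontal_strip_def skew_diagram_singleton_Nil SP_iff diag_subset_def card_image inj_on_def)
  have Cons: "z # M \<in> strips r [x] \<longleftrightarrow> M = [] \<and> r < x \<and> z = x - r" for z M
  proof -
    have H: "horizontal_strip r [x] [z] \<longleftrightarrow> x - z \<le> r \<and> r \<le> x - z"
      using horizontal_strip_Cons[of "[]" z r x "[]"] by (auto simp: horizontal_strip_def)
    have "z # M \<in> strips r [x] \<longleftrightarrow> M = [] \<and> 0 < z \<and> z \<le> x \<and> horizontal_strip r [x] [z]"
      using diag_subset_Nil[of M] by (auto simp: strips_def SP_iff diag_subset_Cons)
    then show ?thesis unfolding H using assms by auto
  qed
  show ?thesis
  proof (intro set_eqI)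
    fix \<xi>
    show "\<xi> \<in> strips r [x] \<longleftrightarrow> \<xi> \<in> (if r < x then {[x - r]} else if r = x then {[]} else {})"
      by (cases \<xi>) (use assms in \<open>auto simp: Nil Cons\<close>)
  qed
qed

text \<open>Here \<open>d\<close> counts the boxes in the first row;
  \<open>horizontal_strip_second_row\<close> bounds it by \<open>x - y\<close>. The strictness
  condition \<open>part \<xi> 0 < x - d\<close> can fail only if \<open>d = x - y\<close> and
  \<open>\<xi>\<close> begins with \<open>y\<close>, which are the terms that
  \<open>Qop_Qop_same\<close> removes in \<open>transl_Qfun\<close>.\<close>

lemma strips_Cons_Cons:
  assumes "sorted_wrt (>) (x # y # L)" and "0 < y"
  shows "strips r (x # y # L) = (\<lambda>(d, \<xi>). (x - d) # \<xi>) `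
    {(d, \<xi>). d \<le> min r (x - y) \<and> \<xi> \<in> strips (r - d) (y # L) \<and> part \<xi> 0 < x - d}" (is "_ = ?R")
proof (intro set_eqI)
  fix \<xi>
  have "y < x" and sorted: "sorted_wrt (>) (y # L)" using assms by auto
  show "\<xi> \<in> strips r (x # y # L) \<longleftrightarrow> \<xi> \<in> ?R"
  proof (cases \<xi>)
    case Nil
    have "\<not> horizontal_strip r (x # y # L) []"
      using horizontal_strip_second_row[of r x y L "[]"] \<open>y < x\<close> assms(2) by auto
    then show ?thesis by (auto simp: Nil strips_def)
  next
    case (Cons z M)
    have "\<xi> \<in> strips r (x # y # L) \<longleftrightarrow>
        y \<le> z \<and> z \<le> x \<and> x - z \<le> r \<and> M \<in> strips (r - (x - z)) (y # L) \<and> part M 0 < z"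
    proof (cases "y \<le> z")
      case True
      with assms(2) have "0 < z" by simp
      have H: "horizontal_strip r (x # y # L) (z # M) \<longleftrightarrow> x - z \<le> r \<and> horizontal_strip (r - (x - z)) (y # L) M"
        using True by (intro horizontal_strip_Cons sorted) simp
      show ?thesis
        using True \<open>0 < z\<close> sorted_Cons_iff[of z M]
        unfolding Cons strips_def mem_Collect_eq SP_iff H diag_subset_Cons by auto
    next
      case False
      have "\<not> (horizontal_strip r (x # y # L) \<xi> \<and> sorted_wrt (>) \<xi> \<and> 0 \<notin> set \<xi>)"
        using horizontal_strip_second_row[of r x y L \<xi>, OF _ _ assms(2) \<open>y < x\<close>] False Cons by force
      then show ?thesis using False unfolding strips_def mem_Collect_eq SP_iff by blast
    qed
    also have "\<dots> \<longleftrightarrow> \<xi> \<in> ?R"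
    proof
      assume *: "y \<le> z \<and> z \<le> x \<and> x - z \<le> r \<and> M \<in> strips (r - (x - z)) (y # L) \<and> part M 0 < z"
      then show "\<xi> \<in> ?R"
        by (intro image_eqI[of _ _ "(x - z, M)"]) (auto simp: Cons)
    next
      assume "\<xi> \<in> ?R"
      then show "y \<le> z \<and> z \<le> x \<and> x - z \<le> r \<and> M \<in> strips (r - (x - z)) (y # L) \<and> part M 0 < z"
        using \<open>y < x\<close> by (auto simp: Cons)
    qed
    finally show ?thesis .
  qed
qed

lemma finite_strips:
  assumes "sorted_wrt (>) lam" and "0 \<notin> set lam"
  shows "finite (strips r lam)"
  using assms
proof (induction lam arbitrary: r rule: induct_list012)
  case (3 x y L)
  have "finite (SIGMA d:{..min r (x - y)}. strips (r - d) (y # L))"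
    using 3 by (intro finite_SigmaI) auto
  moreover have "0 < y" using 3(4) by auto
  ultimately show ?case
    unfolding strips_Cons_Cons[OF 3(3) \<open>0 < y\<close>]
    by (intro finite_imageI) (auto elim!: rev_finite_subset)
qed (auto simp: strips_Nil strips_singleton)

definition strip_columns :: "nat list \<Rightarrow> nat list \<Rightarrow> nat set" where
  "strip_columns lam \<xi> = snd ` skew_diagram lam \<xi>"

text \<open>The statistic depends on the occupied columns only and counts their maximal runs by
  right ends.\<close>

lemma strip_a_eq: "strip_a lam \<xi> = card {j \<in> strip_columns lam \<xi>. Suc j \<notin> strip_columns lam \<xi>}"
proof -
  have "{j. 1 \<le> j \<and> (\<exists>i. (i, j) \<in> skew_diagram lam \<xi>) \<and> \<not> (\<exists>i. (i, j + 1) \<in> skew_diagram lam \<xi>)}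
      = {j \<in> strip_columns lam \<xi>. Suc j \<notin> strip_columns lam \<xi>}"
    unfolding strip_columns_def image_iff by (auto simp: Bex_def skew_diagram_def)
  then show ?thesis by (simp add: strip_a_def)
qed

lemma strip_columns_Cons: "strip_columns (x # L) (z # M) = {z<..x} \<union> strip_columns L M"
  unfolding strip_columns_def skew_diagram_Cons image_Un image_image by auto

text \<open>The first row occupies the columns from \<open>z + 1\<close> to \<open>x\<close>. This
  adds a run unless it is empty or continues a run ending at \<open>z\<close>. The latter happens
  exactly for \<open>z = y\<close>, since then \<open>part M 0 < y\<close> makes column
  \<open>y\<close> occupied, while columns beyond \<open>y\<close> are not.\<close>

lemma strip_a_Cons:
  assumes sorted: "sorted_wrt (>) (y # L)" and "y \<le> z" "z \<le> x" "y < x" and "part M 0 < z"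
  shows "strip_a (x # y # L) (z # M) = strip_a (y # L) M + (if z = x \<or> z = y then 0 else 1)"
proof -
  let ?C = "strip_columns (y # L) M"
  let ?E = "\<lambda>C. {j \<in> C. Suc j \<notin> C}"
  have le: "j \<le> y" if "j \<in> ?C" for j
    using that skew_diagram_column_le[OF sorted] by (auto simp: strip_columns_def)
  have fin: "finite ?C" unfolding strip_columns_def by (intro finite_imageI finite_skew_diagram sorted)
  show ?thesis
  proof (cases "z = x")
    case True
    then show ?thesis by (simp add: strip_a_eq strip_columns_Cons)
  next
    case False
    \<comment> \<open>The new run ends at \<open>x\<close>, and \<open>z\<close> ceases to be a
      right end if it was one.\<close>
    have E: "?E ({z<..x} \<union> ?C) = insert x (?E ?C - {z})"
    proof (intro set_eqI)
      fix j
      show "j \<in> ?E ({z<..x} \<union> ?C) \<longleftrightarrow> j \<in> insert x (?E ?C - {z})"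
        using le[of j] le[of "Suc j"] assms False by (cases "j = x"; cases "j = z") auto
    qed
    have notin: "x \<notin> ?E ?C - {z}" using le[of x] assms by auto
    have card: "card (?E ({z<..x} \<union> ?C)) = Suc (card (?E ?C - {z}))"
      unfolding E using notin fin by (subst card_insert_disjoint) auto
    show ?thesis
    proof (cases "z = y")
      case True
      have "(0, y) \<in> skew_diagram (y # L) M" using assms True by (auto simp: skew_diagram_def)
      then have "y \<in> ?C" unfolding strip_columns_def by force
      then have "z \<in> ?E ?C" using True le[of "Suc y"] by auto
      then have "Suc (card (?E ?C - {z})) = card (?E ?C)"
        using fin by (intro card_Suc_Diff1) auto
      then show ?thesis using True card by (simp add: strip_a_eq strip_columns_Cons)
    next
      case zy: False
      then have "?E ?C - {z} = ?E ?C" using le[of z] assms by auto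
      then show ?thesis using zy False card by (simp add: strip_a_eq strip_columns_Cons)
    qed
  qed
qed

lemma strip_a_singleton: "r < x \<Longrightarrow> strip_a [x] [x - r] = (if r = 0 then 0 else 1)"
  and strip_a_singleton_Nil: "0 < x \<Longrightarrow> strip_a [x] [] = 1"
proof -
  have E: "{j \<in> {z<..x}. Suc j \<notin> {z<..x}} = (if z < x then {x} else {})" for z by auto
  have "strip_columns [x] [x - r] = {x - r<..x}" "strip_columns [x] [] = {0<..x}"
    using strip_columns_Cons[of x "[]" "x - r" "[]"]
    by (simp_all add: strip_columns_def skew_diagram_singleton_Nil image_image)
  then show "r < x \<Longrightarrow> strip_a [x] [x - r] = (if r = 0 then 0 else 1)"
    "0 < x \<Longrightarrow> strip_a [x] [] = 1"
    by (simp_all add: strip_a_eq E del: greaterThanAtMost_iff)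
qed

section \<open>The adjoint Pieri rule for Q-functions\<close>

lemma Qfun_Nil [simp]: "Qfun [] = 1"
  and Qfun_Cons: "Qfun (x # L) = Qop (int x) (Qfun L)"
  by (simp_all add: Qfun_def)

text \<open>Induction on the rows: the factor 1 or 2 that \<open>transl_Qop_Qop\<close> attaches to
  the first row is the change of the power of 2 in \<open>strip_a_Cons\<close>.\<close>

lemma transl_Qfun:
  assumes "sorted_wrt (>) lam" and "0 \<notin> set lam"
  shows "transl k (Qfun lam) = (\<Sum>\<xi>\<in>strips k lam. scal (2 ^ strip_a lam \<xi>) * Qfun \<xi>)"
  using assms
proof (induction lam arbitrary: k rule: induct_list012)
  case 1
  have "strip_a [] [] = 0" by (simp add: strip_a_eq strip_columns_def)
  then show ?case by (simp add: strips_Nil transl_1)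
next
  case (2 x)
  then have "0 < x" by simp
  have "transl k (Qfun [x]) = weight k * one_row (int x - int k)"
    by (simp add: Qfun_Cons Qop_1 transl_one_row)
  \<comment> \<open>For \<open>k = x\<close> the whole row is removed and \<open>one_row 0\<close>
    is 1; for \<open>k > x\<close> the index is negative and there is no strip.\<close>
  also have "\<dots> = (\<Sum>\<xi>\<in>strips k [x]. scal (2 ^ strip_a [x] \<xi>) * Qfun \<xi>)"
    using \<open>0 < x\<close>
    by (auto simp: strips_singleton strip_a_singleton strip_a_singleton_Nil Qfun_Cons Qop_1
        one_row_diff one_row_int weight_def creation_eq)
  finally show ?case .
next
  case (3 x y L)
  then have "y < x" "0 < y" and sorted: "sorted_wrt (>) (y # L)" and nz: "0 \<notin> set (y # L)" by auto
  let ?v = "\<lambda>d. if d = 0 \<or> d = x - y then 1 else 2 :: gamma"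
  let ?S = "SIGMA d:{..min k (x - y)}. strips (k - d) (y # L)"
  let ?t = "\<lambda>(d, \<xi>). ?v d * (scal (2 ^ strip_a (y # L) \<xi>) * Qfun ((x - d) # \<xi>))"
  have "transl k (Qfun (x # y # L))
      = (\<Sum>d\<le>min k (x - y). ?v d * Qop (int x - int d) (transl (k - d) (Qfun (y # L))))"
    unfolding Qfun_Cons by (rule transl_Qop_Qop) fact+
  also have "\<dots> = (\<Sum>d\<le>min k (x - y). \<Sum>\<xi>\<in>strips (k - d) (y # L). ?t (d, \<xi>))"
  proof (rule sum.cong)
    fix d assume "d \<in> {..min k (x - y)}"
    then have eq: "int x - int d = int (x - d)" using \<open>y < x\<close> by auto
    show "?v d * Qop (int x - int d) (transl (k - d) (Qfun (y # L)))
        = (\<Sum>\<xi>\<in>strips (k - d) (y # L). ?t (d, \<xi>))"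
      unfolding eq 3(2)[OF sorted nz] Qop_sum Qop_scal_times sum_distrib_left prod.case
        Qfun_Cons[of "x - d"] ..
  qed simp
  also have "\<dots> = sum ?t ?S"
    by (subst sum.Sigma) (use finite_strips[OF sorted nz] in auto)
  \<comment> \<open>For the dropped pairs, \<open>y \<le> x - d \<le> part \<xi> 0 \<le> y\<close>
    forces \<open>\<xi>\<close> to begin with \<open>x - d = y\<close>, and the repeated operator
    gives 0.\<close>
  also have "\<dots> = sum ?t {(d, \<xi>). d \<le> min k (x - y) \<and> \<xi> \<in> strips (k - d) (y # L) \<and> part \<xi> 0 < x - d}"
  proof (rule sum.mono_neutral_right)
    show "finite ?S" using finite_strips[OF sorted nz] by auto
    show "\<forall>p\<in>?S - {(d, \<xi>). d \<le> min k (x - y) \<and> \<xi> \<in> strips (k - d) (y # L) \<and> part \<xi> 0 < x - d}. ?t p = 0"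
    proof
      fix p assume p: "p \<in> ?S - {(d, \<xi>). d \<le> min k (x - y) \<and> \<xi> \<in> strips (k - d) (y # L) \<and> part \<xi> 0 < x - d}"
      obtain d \<xi> where d: "p = (d, \<xi>)" by fastforce
      with p have *: "d \<le> x - y" "\<xi> \<in> strips (k - d) (y # L)" "x - d \<le> part \<xi> 0" by auto
      then have "part \<xi> 0 \<le> part (y # L) 0" unfolding strips_def diag_subset_def by blast
      with * \<open>y < x\<close> have eq: "part \<xi> 0 = x - d" "x - d = y" by auto
      with \<open>0 < y\<close> obtain M where "\<xi> = (x - d) # M" by (cases \<xi>) auto
      then have "Qfun ((x - d) # \<xi>) = 0"
        using eq \<open>0 < y\<close> by (simp add: Qfun_Cons Qop_Qop_same)
      then show "?t p = 0" by (simp add: d)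
    qed
  qed auto
  also have "\<dots> = (\<Sum>\<xi>\<in>strips k (x # y # L). scal (2 ^ strip_a (x # y # L) \<xi>) * Qfun \<xi>)"
    unfolding strips_Cons_Cons[OF 3(3) \<open>0 < y\<close>]
  proof (subst sum.reindex)
    show "inj_on (\<lambda>(d, \<xi>). (x - d) # \<xi>)
        {(d, \<xi>). d \<le> min k (x - y) \<and> \<xi> \<in> strips (k - d) (y # L) \<and> part \<xi> 0 < x - d}"
      using \<open>y < x\<close> by (auto simp: inj_on_def)
  next
    show "sum ?t {(d, \<xi>). d \<le> min k (x - y) \<and> \<xi> \<in> strips (k - d) (y # L) \<and> part \<xi> 0 < x - d}
      = sum ((\<lambda>\<xi>. scal (2 ^ strip_a (x # y # L) \<xi>) * Qfun \<xi>) \<circ> (\<lambda>(d, \<xi>). (x - d) # \<xi>))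
          {(d, \<xi>). d \<le> min k (x - y) \<and> \<xi> \<in> strips (k - d) (y # L) \<and> part \<xi> 0 < x - d}"
    proof (rule sum.cong)
      fix p assume p: "p \<in> {(d, \<xi>). d \<le> min k (x - y) \<and> \<xi> \<in> strips (k - d) (y # L) \<and> part \<xi> 0 < x - d}"
      obtain d \<xi> where d: "p = (d, \<xi>)" by fastforce
      with p have *: "d \<le> x - y" "part \<xi> 0 < x - d" by auto
      have "strip_a (x # y # L) ((x - d) # \<xi>) = strip_a (y # L) \<xi> + (if x - d = x \<or> x - d = y then 0 else 1)"
        using * \<open>y < x\<close> by (intro strip_a_Cons sorted) auto
      moreover have "x - d = x \<or> x - d = y \<longleftrightarrow> d = 0 \<or> d = x - y" using * \<open>y < x\<close> by auto
      ultimately show "?t p = ((\<lambda>\<xi>. scal (2 ^ strip_a (x # y # L) \<xi>) * Qfun \<xi>) \<circ> (\<lambda>(d, \<xi>). (x - d) # \<xi>)) p"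
        by (simp add: d scal_mult mult.assoc)
    qed simp
  qed
  finally show ?case .
qed

section \<open>Translation of the g-functions and the main recursion\<close>

lemma q_plus_1_nonzero: "q + 1 \<noteq> 0" and q_minus_1_nonzero: "q - 1 \<noteq> 0"
proof -
  have "q + 1 = Fract [:1, 1:] 1" "q - 1 = Fract [:-1, 1:] 1"
    by (simp_all add: q_def One_fract_def one_pCons)
  then show "q + 1 \<noteq> 0" "q - 1 \<noteq> 0"
    by (simp_all add: Zero_fract_def eq_fract)
qed

text \<open>Coefficients of (1 + qx) (1 - x) / ((1 - qx) (1 + x)). The value at 0 is separate
  because \<open>qnum 0 = 1\<close> would give \<open>2 * (q - 1)\<close>.\<close>

definition g_coeff :: "nat \<Rightarrow> ratfun" where
  "g_coeff k = (if k = 0 then 1 else 2 * (q - 1) * qnum k)"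

text \<open>The two sums are compared separately, in closed form for even and for odd \<open>k\<close>; the
  recursion of \<open>transl_odd_exp\<close> is their difference.\<close>

lemma g_coeff_sums:
  fixes k :: nat
  defines "\<alpha> \<equiv> 2 * (q - 1) / (q + 1)"
  shows "(\<Sum>j\<le>k. if odd j then g_coeff (k - j) else 0) = (if even k 
     then \<alpha> * (q * (q ^ k - 1) / (q * q - 1) + of_nat (k div 2))
     else 1 + \<alpha> * ((q ^ (k + 1) - 1) / (q * q - 1) - of_nat (k div 2 + 1)))"
    and "(\<Sum>j\<le>k. if odd j then q ^ j * g_coeff (k - j) else 0) = (if even k 
     then \<alpha> * (of_nat (k div 2) * q ^ k + q * (q ^ k - 1) / (q * q - 1))
     else q ^ k + \<alpha> * (of_nat (k div 2 + 1) * q ^ k - q * (q ^ (k + 1) - 1) / (q * q - 1)))"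
proof -
  have q2: "q * q - 1 \<noteq> 0"
    using q_plus_1_nonzero q_minus_1_nonzero by (simp add: square_eq_1_iff eq_neg_iff_add_eq_0)
  have g: "g_coeff k = \<alpha> * (q ^ k - (- 1) ^ k)" if "k > 0" for k
    using that by (simp add: g_coeff_def qnum_def \<alpha>_def)
  define U where "U k = (\<Sum>j\<le>k. if odd j then g_coeff (k - j) else 0)" for k
  define V where "V k = (\<Sum>j\<le>k. if odd j then q ^ j * g_coeff (k - j) else 0)" for k
  \<comment> \<open>Only odd \<open>j\<close> count, so a shift of the summation index by 2 relates
    \<open>k + 2\<close> to \<open>k\<close>.\<close>
  have U: "U (Suc (Suc k)) = g_coeff (Suc k) + U k" for k
    unfolding U_def by (simp add: sum.atMost_Suc_shift Suc_diff_Suc del: sum.atMost_Suc cong: if_cong)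
  have V: "V (Suc (Suc k)) = q * g_coeff (Suc k) + q * q * V k" for k
    unfolding V_def by (simp add: sum.atMost_Suc_shift Suc_diff_Suc sum_distrib_left if_distrib mult.assoc
       del: sum.atMost_Suc cong: if_cong)
  show "U k = (if even k then \<alpha> * (q * (q ^ k - 1) / (q * q - 1) + of_nat (k div 2))
     else 1 + \<alpha> * ((q ^ (k + 1) - 1) / (q * q - 1) - of_nat (k div 2 + 1)))"
  proof (induction k rule: induct_nat_012)
    case (ge2 k)
    show ?case unfolding U ge2(1) g[OF zero_less_Suc] using q2
      by (auto simp: field_simps)
  qed (use q2 in \<open>auto simp: U_def g_coeff_def\<close>)
  show "V k = (if even k then \<alpha> * (of_nat (k div 2) * q ^ k + q * (q ^ k - 1) / (q * q - 1))
     else q ^ k + \<alpha> * (of_nat (k div 2 + 1) * q ^ k - q * (q ^ (k + 1) - 1) / (q * q - 1)))"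
  proof (induction k rule: induct_nat_012)
    case (ge2 k)
    show ?case unfolding V ge2(1) g[OF zero_less_Suc] using q2
      by (auto simp: field_simps)
  qed (use q2 in \<open>auto simp: V_def g_coeff_def\<close>)
qed

lemma g_coeff_rec: "of_nat k * g_coeff k = (\<Sum>j\<le>k. if odd j then 2 * (q ^ j - 1) * g_coeff (k - j) else 0)"
proof -
  define \<alpha> where "\<alpha> = 2 * (q - 1) / (q + 1)"
  have q2: "q * q - 1 = (q + 1) * (q - 1)" by (simp add: algebra_simps)
  have g: "g_coeff k = \<alpha> * (q ^ k - (- 1) ^ k)" if "k > 0" for k
    using that by (simp add: g_coeff_def qnum_def \<alpha>_def)
  have "(\<Sum>j\<le>k. if odd j then 2 * (q ^ j - 1) * g_coeff (k - j) else 0)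
      = 2 * ((\<Sum>j\<le>k. if odd j then q ^ j * g_coeff (k - j) else 0) - (\<Sum>j\<le>k. if odd j then g_coeff (k - j) else 0))"
    unfolding sum_subtractf[symmetric] sum_distrib_left by (intro sum.cong) (auto simp: algebra_simps)
  also have "\<dots> = of_nat k * g_coeff k"
  proof (cases "even k")
    case True
    then obtain m where m: "k = 2 * m" by (elim evenE)
    show ?thesis
      unfolding g_coeff_sums \<alpha>_def[symmetric] using True
      by (cases "k = 0") (simp_all add: g, simp_all add: m algebra_simps)
  next
    case False
    then obtain m where m: "k = 2 * m + 1" by (elim oddE)
    \<comment> \<open>With \<open>q ^ (2 * m)\<close> and \<open>of_nat m\<close> abbreviated, the
      odd case is one rational identity in \<open>q\<close>, \<open>Y\<close> and
      \<open>M\<close>.\<close>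
    define Y where "Y = q ^ (2 * m)"
    have Y: "q ^ k = q * Y" "k div 2 = m" by (simp_all add: m Y_def)
    define M where "M = (of_nat m :: ratfun)"
    have k: "(of_nat k :: ratfun) = 2 * M + 1" by (simp add: m M_def)
    have "2 * (q * Y + \<alpha> * ((M + 1) * (q * Y) - q * (q * (q * Y) - 1) / ((q + 1) * (q - 1)))
          - (1 + \<alpha> * ((q * (q * Y) - 1) / ((q + 1) * (q - 1)) - (M + 1))))
        = (2 * M + 1) * (\<alpha> * (q * Y + 1))"
      using q_plus_1_nonzero q_minus_1_nonzero unfolding \<alpha>_def
      by (simp add: divide_simps) (simp add: algebra_simps)
    then show ?thesis
      unfolding g_coeff_sums \<alpha>_def[symmetric] q2 k using False
      by (simp add: g odd_pos Y M_def add.commute[of 1])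
  qed
  finally show ?thesis by simp
qed

lemma transl_g: "transl k (fps_nth g_series n)
    = (if k \<le> n then scal (g_coeff k) * fps_nth g_series (n - k) else 0)"
proof -
  have "g_series = odd_exp (\<lambda>n. 2 * (q ^ n - 1))"
    unfolding g_series_def odd_exp_def ..
  then show ?thesis
    using transl_odd_exp[of g_coeff "\<lambda>n. 2 * (q ^ n - 1)", OF _ g_coeff_rec] by (simp add: g_coeff_def)
qed

section \<open>Subcompositions and products of g-functions\<close>

lemma subcomps_Nil: "subcomps [] i = (if i = 0 then {[]} else {})"
  by (auto simp: subcomps_def)

lemma subcomps_Cons: "subcomps (a # \<mu>) i = (\<lambda>(t, \<tau>). t # \<tau>) ` (SIGMA t:{..min a i}. subcomps \<mu> (i - t))"
proof (intro set_eqI)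
  fix \<tau>
  have split: "(\<forall>j<Suc n. P j) \<longleftrightarrow> P 0 \<and> (\<forall>j<n. P (Suc j))" for P :: "nat \<Rightarrow> bool" and n
    by (rule All_less_Suc2)
  show "\<tau> \<in> subcomps (a # \<mu>) i \<longleftrightarrow> \<tau> \<in> (\<lambda>(t, \<tau>). t # \<tau>) ` (SIGMA t:{..min a i}. subcomps \<mu> (i - t))"
    by (cases \<tau>) (auto simp: subcomps_def split image_iff)
qed

lemma finite_subcomps: "finite (subcomps \<mu> i)"
  by (induction \<mu> arbitrary: i) (auto simp: subcomps_Nil subcomps_Cons)

lemma subcomps_empty:
  assumes "sum_list \<mu> < i"
  shows "subcomps \<mu> i = {}"
  using assms by (induction \<mu> arbitrary: i) (auto simp: subcomps_Nil subcomps_Cons)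

text \<open>Multiplicativity distributes the degree \<open>i\<close> over the factors, and
  \<open>transl_g\<close> bounds the share of each factor by its index.\<close>

lemma transl_gfun:
  "transl i (gfun \<mu>) = (\<Sum>\<tau>\<in>subcomps \<mu> i. scal (prod_list (map g_coeff \<tau>)) * gfun (comp_diff \<mu> \<tau>))"
proof (induction \<mu> arbitrary: i)
  case Nil
  show ?case by (simp add: subcomps_Nil gfun_def transl_1 comp_diff_def)
next
  case (Cons a \<mu>)
  let ?F = "\<lambda>\<tau>. scal (prod_list (map g_coeff \<tau>)) * gfun (comp_diff (a # \<mu>) \<tau>)"
  have "transl i (gfun (a # \<mu>)) = (\<Sum>t\<le>i. transl t (fps_nth g_series a) * transl (i - t) (gfun \<mu>))"
    by (simp add: gfun_def transl_mult)
  also have "\<dots> = (\<Sum>t\<le>min a i. \<Sum>\<tau>\<in>subcomps \<mu> (i - t). ?F (t # \<tau>))"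
  proof (rule sum.mono_neutral_cong_right)
    fix t assume "t \<in> {..min a i}"
    then show "transl t (fps_nth g_series a) * transl (i - t) (gfun \<mu>) = (\<Sum>\<tau>\<in>subcomps \<mu> (i - t). ?F (t # \<tau>))"
      unfolding Cons.IH by (simp add: transl_g sum_distrib_left gfun_def comp_diff_def scal_mult mult_ac)
  qed (auto simp: transl_g)
  also have "\<dots> = (\<Sum>\<tau>\<in>subcomps (a # \<mu>) i. ?F \<tau>)"
    unfolding subcomps_Cons
    by (subst sum.reindex) (auto simp: inj_on_def sum.Sigma finite_subcomps split_beta)
  finally show ?case .
qed

text \<open>Zero parts contribute 1 on both sides. The nonzero parts are the source of the powers of
  2 and \<open>q - 1\<close> with exponent l(\<tau>) in the theorem.\<close>

lemma prod_list_g_coeff: "prod_list (map g_coeff \<tau>) = (2 * (q - 1)) ^ num_parts \<tau> * qnum_comp \<tau>"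
  by (induction \<tau>) (auto simp: num_parts_def qnum_comp_def g_coeff_def qnum_def)

text \<open>Inserts both translation formulas into \<open>form_Qop\<close>, with
  \<open>i = x + m\<close>.\<close>

lemma form_gfun_Qfun_Cons:
  assumes "sorted_wrt (>) L" and "0 \<notin> set L" and "sum_list \<mu> = n"
  shows "form (gfun \<mu>) (Qfun (x # L)) = (\<Sum>i = x..n. \<Sum>\<tau>\<in>subcomps \<mu> i. \<Sum>\<xi>\<in>strips (i - x) L.
    (- 1) ^ (i - x) * prod_list (map g_coeff \<tau>) * 2 ^ strip_a L \<xi> * form (gfun (comp_diff \<mu> \<tau>)) (Qfun \<xi>))"
proof -
  obtain N where N: "\<And>m. m \<ge> N \<Longrightarrow> transl m (Qfun L) = 0" using transl_eventually_0 by metis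
  \<comment> \<open>The range has to contain every \<open>m\<close> with
    \<open>x + m \<le> n\<close>; for larger \<open>m\<close> there are no subcompositions of
    \<open>\<mu>\<close>.\<close>
  define N' where "N' = max N (Suc n)"
  have N': "transl m (Qfun L) = 0" if "m \<ge> N'" for m using that N by (simp add: N'_def)
  have "form (gfun \<mu>) (Qfun (x # L)) = (\<Sum>m<N'. (- 1) ^ m * form (transl (x + m) (gfun \<mu>)) (transl m (Qfun L)))"
    unfolding Qfun_Cons by (rule form_Qop[OF N'])
  also have "\<dots> = (\<Sum>m\<in>{m. x + m \<le> n}. (- 1) ^ m * form (transl (x + m) (gfun \<mu>)) (transl m (Qfun L)))"
    by (rule sum.mono_neutral_right) (auto simp: N'_def transl_gfun subcomps_empty assms(3) not_le)
  also have "\<dots> = (\<Sum>i = x..n. (- 1) ^ (i - x) * form (transl i (gfun \<mu>)) (transl (i - x) (Qfun L)))"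
    by (rule sum.reindex_bij_witness[of _ "\<lambda>i. i - x" "\<lambda>m. x + m"]) auto
  also have "\<dots> = (\<Sum>i = x..n. \<Sum>\<tau>\<in>subcomps \<mu> i. \<Sum>\<xi>\<in>strips (i - x) L.
    (- 1) ^ (i - x) * prod_list (map g_coeff \<tau>) * 2 ^ strip_a L \<xi> * form (gfun (comp_diff \<mu> \<tau>)) (Qfun \<xi>))"
  proof (rule sum.cong)
    fix i
    have right: "form f (transl r (Qfun L)) = (\<Sum>\<xi>\<in>strips r L. 2 ^ strip_a L \<xi> * form f (Qfun \<xi>))" for f r
      unfolding transl_Qfun[OF assms(1,2)] by (subst (1 2) form_sym) (simp add: form_sum_left form_scal_left)
    show "(- 1) ^ (i - x) * form (transl i (gfun \<mu>)) (transl (i - x) (Qfun L))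
      = (\<Sum>\<tau>\<in>subcomps \<mu> i. \<Sum>\<xi>\<in>strips (i - x) L.
          (- 1) ^ (i - x) * prod_list (map g_coeff \<tau>) * 2 ^ strip_a L \<xi> * form (gfun (comp_diff \<mu> \<tau>)) (Qfun \<xi>))"
      unfolding transl_gfun form_sum_left form_scal_left right sum_distrib_left
      by (subst sum.swap) (simp add: mult_ac)
  qed simp
  finally show ?thesis .
qed

theorem theorem3p1:
  fixes n :: nat and lam mu :: "nat list"
  assumes "lam \<in> SP n" and "mu \<in> OP n"
  shows "zeta lam mu =
    (\<Sum>i = part lam 0..n. \<Sum>\<tau>\<in>subcomps mu i.
      \<Sum>\<xi> | (\<exists>k. \<xi> \<in> SP k) \<and> diag_subset \<xi> (tl lam) \<and> horizontal_strip (i - part lam 0) (tl lam) \<xi>.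
        (- 1) ^ (i - part lam 0)
        * 2 powi (int (eps \<xi>) - int (eps lam) + int (num_parts \<tau>) + int (strip_a (tl lam) \<xi>))
        * (q - 1) powi (int (num_parts \<tau>) + int (num_parts (comp_diff mu \<tau>)) - int (num_parts mu))
        * qnum_comp \<tau> * zeta \<xi> (comp_diff mu \<tau>))"
proof (cases lam)
  \<comment> \<open>Since \<open>part [] 0 = 0\<close> and \<open>tl [] = []\<close>, the only term
    has \<open>i = 0\<close> and empty \<open>\<tau>\<close> and \<open>\<xi>\<close>.\<close>
  case Nil
  then have "mu = []" "n = 0" using assms by (cases mu; auto simp: SP_def OP_def)+
  have "strip_a [] [] = 0" by (simp add: strip_a_eq strip_columns_def)
  with Nil \<open>mu = []\<close> \<open>n = 0\<close> show ?thesis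
    by (simp add: strips_Nil subcomps_Nil comp_diff_def num_parts_def qnum_comp_def flip: strips_def)
next
  case (Cons x L)
  have L: "sorted_wrt (>) L" "0 \<notin> set L" and mu: "sum_list mu = n"
    using assms Cons by (auto simp: SP_def OP_def)
  \<comment> \<open>Here \<open>e'\<close> stands for \<open>eps \<xi>\<close> and \<open>d\<close>
    for the number of nonzero parts of \<open>comp_diff mu \<tau>\<close>; their powers are inserted
    and compensated by the prefactors in \<open>zeta \<xi>\<close>.\<close>
  have factor: "2 powi (- int e) * w powi (- int m) * (s * ((2 * w) ^ t * c) * 2 ^ a * X)
      = s * 2 powi (int e' - int e + int t + int a) * w powi (int t + int d - int m) * c
        * (2 powi (- int e') * w powi (- int d) * X)"
    if "w \<noteq> 0" for w s c X :: ratfun and e e' m t a d :: nat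
    using that by (simp add: power_int_add power_int_diff power_int_minus power_mult_distrib field_simps)
  show ?thesis
    unfolding Cons zeta_def[of "x # L"] list.sel part_Cons_0 strips_def[symmetric]
      form_gfun_Qfun_Cons[OF L mu] sum_distrib_left
    unfolding zeta_def prod_list_g_coeff by (intro sum.cong refl factor q_minus_1_nonzero)
qed

end
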